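(* Let $P$ be a ranked poset of rank $n$ with minimum $\hat0$ and maximum $\hat1$, equipped with a local action of $S_n$ on its set $\mathcal{M}(P)$ of maximal chains. (a) For every $c\in\mathcal{M}(P)$, the stabilizer of $c$ is a Young subgroup $S_{B_1}\times S_{B_2}\times\cdots\times S_{B_k}$ of $S_n$, where $\{B_1,\dots,B_k\}$ is a partition of the set $[n]$ and $S_{B}$ denotes the group of permutations of $[n]$ fixing every element outside $B$. (b) If $\psi$ is the character of the corresponding permutation representation of $S_n$ on $\mathbf{C}\mathcal{M}(P)$, then $\mathrm{ch}(\psi)$ is $h$-positive, i.e., $\mathrm{ch}(\psi)=\sum_{\nu\vdash n}a_\nu h_\nu$ with all $a_\nu\ge 0$. (c) If $\mathrm{ch}(\psi)=h_\nu$ for some partition $\nu=(\nu_1,\nu_2,\dots)\vdash n$, then $P\cong C_{\nu_1+1}\times C_{\nu_2+1}\times\cdots$.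
   Context: A local action of $S_n$ on $\mathcal{M}(P)$ is an action of $S_n$ on the set $\mathcal{M}(P)$ such that for each adjacent transposition $\sigma_i=(i,i+1)$, $1\le i\le n-1$, and each maximal chain $m$, the chain $\sigma_i(m)$ differs from $m$ at most in the element of rank $i$. $\mathrm{ch}$ denotes the Frobenius characteristic map from class functions of $S_n$ to symmetric functions of degree $n$; $h_\nu=h_{\nu_1}h_{\nu_2}\cdots$ is the complete homogeneous symmetric function. $C_i$ denotes a chain with $i$ elements. *)

theory Defs
  imports Complex_Main "HOL-Library.Poly_Mapping" "HOL-Library.Disjoint_Sets"
    "HOL-Combinatorics.Permutations" "HOL-Combinatorics.Transposition"
    "HOL-Combinatorics.Orbits"
begin

definition partial_order_on' :: "'a set \<Rightarrow> ('a \<Rightarrow> 'a \<Rightarrow> bool) \<Rightarrow> bool" where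
  "partial_order_on' P le \<longleftrightarrow>
     (\<forall>x\<in>P. le x x) \<and>
     (\<forall>x\<in>P. \<forall>y\<in>P. le x y \<and> le y x \<longrightarrow> x = y) \<and>
     (\<forall>x\<in>P. \<forall>y\<in>P. \<forall>z\<in>P. le x y \<and> le y z \<longrightarrow> le x z)"

definition is_chain :: "'a set \<Rightarrow> ('a \<Rightarrow> 'a \<Rightarrow> bool) \<Rightarrow> 'a set \<Rightarrow> bool" where
  "is_chain P le C \<longleftrightarrow> C \<subseteq> P \<and> (\<forall>x\<in>C. \<forall>y\<in>C. le x y \<or> le y x)"

definition max_chains :: "'a set \<Rightarrow> ('a \<Rightarrow> 'a \<Rightarrow> bool) \<Rightarrow> 'a set set" where
  "max_chains P le = {C. is_chain P le C \<and> (\<forall>D. is_chain P le D \<and> C \<subseteq> D \<longrightarrow> D = C)}"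

definition ranked_bounded_poset ::
  "'a set \<Rightarrow> ('a \<Rightarrow> 'a \<Rightarrow> bool) \<Rightarrow> 'a \<Rightarrow> 'a \<Rightarrow> nat \<Rightarrow> bool" where
  "ranked_bounded_poset P le bot0 top1 n \<longleftrightarrow>
     finite P \<and> partial_order_on' P le \<and>
     bot0 \<in> P \<and> top1 \<in> P \<and> (\<forall>x\<in>P. le bot0 x \<and> le x top1) \<and>
     (\<forall>C\<in>max_chains P le. card C = n + 1)"

definition rank_of :: "'a set \<Rightarrow> ('a \<Rightarrow> 'a \<Rightarrow> bool) \<Rightarrow> 'a \<Rightarrow> nat" where
  "rank_of P le x = Max (card ` {C. is_chain P le C \<and> (\<forall>y\<in>C. le y x)}) - 1"

definition Sym :: "nat \<Rightarrow> (nat \<Rightarrow> nat) set" where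
  "Sym n = {p. p permutes {1..n}}"

definition local_action ::
  "'a set \<Rightarrow> ('a \<Rightarrow> 'a \<Rightarrow> bool) \<Rightarrow> nat \<Rightarrow> ((nat \<Rightarrow> nat) \<Rightarrow> 'a set \<Rightarrow> 'a set) \<Rightarrow> bool" where
  "local_action P le n act \<longleftrightarrow>
     (\<forall>p\<in>Sym n. \<forall>m\<in>max_chains P le. act p m \<in> max_chains P le) \<and>
     (\<forall>m\<in>max_chains P le. act id m = m) \<and>
     (\<forall>p\<in>Sym n. \<forall>q\<in>Sym n. \<forall>m\<in>max_chains P le. act (p \<circ> q) m = act p (act q m)) \<and>
     (\<forall>i. 1 \<le> i \<and> i \<le> n - 1 \<longrightarrow> (\<forall>m\<in>max_chains P le.
        {x\<in>act (transpose i (i+1)) m. rank_of P le x \<noteq> i} = {x\<in>m. rank_of P le x \<noteq> i}))"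

definition stabilizer ::
  "'a set \<Rightarrow> ('a \<Rightarrow> 'a \<Rightarrow> bool) \<Rightarrow> nat \<Rightarrow> ((nat \<Rightarrow> nat) \<Rightarrow> 'a set \<Rightarrow> 'a set) \<Rightarrow> 'a set \<Rightarrow> (nat \<Rightarrow> nat) set" where
  "stabilizer P le n act c = {p\<in>Sym n. act p c = c}"

definition Sym_on :: "nat \<Rightarrow> nat set \<Rightarrow> (nat \<Rightarrow> nat) set" where
  "Sym_on n B = {p\<in>Sym n. \<forall>x. x \<notin> B \<longrightarrow> p x = x}"

text \<open>Young subgroup S_{B_1} x ... x S_{B_k} (internal product of commuting
  subgroups with disjoint supports): permutations acting on each block B by some
  element of S_B.\<close>
definition young_subgroup :: "nat \<Rightarrow> nat set set \<Rightarrow> (nat \<Rightarrow> nat) set" where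
  "young_subgroup n Bs = {p\<in>Sym n. \<exists>f. (\<forall>B\<in>Bs. f B \<in> Sym_on n B) \<and>
       (\<forall>B\<in>Bs. \<forall>x\<in>B. p x = f B x) \<and> (\<forall>x. x \<notin> \<Union>Bs \<longrightarrow> p x = x)}"

definition perm_character ::
  "'a set \<Rightarrow> ('a \<Rightarrow> 'a \<Rightarrow> bool) \<Rightarrow> ((nat \<Rightarrow> nat) \<Rightarrow> 'a set \<Rightarrow> 'a set) \<Rightarrow> (nat \<Rightarrow> nat) \<Rightarrow> real" where
  "perm_character P le act p = real (card {m\<in>max_chains P le. act p m = m})"

section \<open>Symmetric functions of degree n, realised in n variables x_0..x_{n-1}\<close>

type_synonym sympoly = "(nat \<Rightarrow>\<^sub>0 nat) \<Rightarrow>\<^sub>0 real"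

definition const_sp :: "real \<Rightarrow> sympoly" where
  "const_sp c = Poly_Mapping.single 0 c"

definition var_sp :: "nat \<Rightarrow> sympoly" where
  "var_sp i = Poly_Mapping.single (Poly_Mapping.single i 1) 1"

definition power_sum :: "nat \<Rightarrow> nat \<Rightarrow> sympoly" where
  "power_sum n k = (\<Sum>i<n. var_sp i ^ k)"

definition complete_h :: "nat \<Rightarrow> nat \<Rightarrow> sympoly" where
  "complete_h n k = (\<Sum>\<alpha>\<in>{\<alpha>. Poly_Mapping.keys \<alpha> \<subseteq> {..<n} \<and> (\<Sum>i<n. Poly_Mapping.lookup \<alpha> i) = k}.
                        Poly_Mapping.single \<alpha> 1)"

definition int_partitions :: "nat \<Rightarrow> nat list set" where
  "int_partitions n = {\<nu>. sorted_wrt (\<ge>) \<nu> \<and> 0 \<notin> set \<nu> \<and> sum_list \<nu> = n}"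

definition h_nu :: "nat \<Rightarrow> nat list \<Rightarrow> sympoly" where
  "h_nu n \<nu> = prod_list (map (complete_h n) \<nu>)"

definition cycles_of :: "nat \<Rightarrow> (nat \<Rightarrow> nat) \<Rightarrow> nat set set" where
  "cycles_of n p = (\<lambda>x. orbit p x) ` {1..n}"

definition power_sum_type :: "nat \<Rightarrow> (nat \<Rightarrow> nat) \<Rightarrow> sympoly" where
  "power_sum_type n p = (\<Prod>Z\<in>cycles_of n p. power_sum n (card Z))"

definition frob_ch :: "nat \<Rightarrow> ((nat \<Rightarrow> nat) \<Rightarrow> real) \<Rightarrow> sympoly" where
  "frob_ch n \<chi> = (\<Sum>p\<in>Sym n. const_sp (\<chi> p / fact n) * power_sum_type n p)"

definition h_positive :: "nat \<Rightarrow> sympoly \<Rightarrow> bool" where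
  "h_positive n f \<longleftrightarrow> (\<exists>a :: nat list \<Rightarrow> real. (\<forall>\<nu>. a \<nu> \<ge> 0) \<and>
       f = (\<Sum>\<nu>\<in>int_partitions n. const_sp (a \<nu>) * h_nu n \<nu>))"

text \<open>C_{nu_1+1} x C_{nu_2+1} x ...: tuples (a_1,...,a_k) with 0 <= a_i <= nu_i,
  componentwise order (tuples as functions, bot0 beyond length nu).\<close>
definition chain_product :: "nat list \<Rightarrow> (nat \<Rightarrow> nat) set" where
  "chain_product \<nu> = {f. (\<forall>i<length \<nu>. f i \<le> \<nu> ! i) \<and> (\<forall>i\<ge>length \<nu>. f i = 0)}"

definition poset_iso_to_chain_product ::
  "'a set \<Rightarrow> ('a \<Rightarrow> 'a \<Rightarrow> bool) \<Rightarrow> nat list \<Rightarrow> bool" where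
  "poset_iso_to_chain_product P le \<nu> \<longleftrightarrow>
     (\<exists>\<phi>. bij_betw \<phi> P (chain_product \<nu>) \<and>
          (\<forall>x\<in>P. \<forall>y\<in>P. le x y \<longleftrightarrow> (\<forall>i. \<phi> x i \<le> \<phi> y i)))"

end

theory Submission
  imports Defs "HOL-Computational_Algebra.Polynomial"
begin

text \<open>
  Fix a maximal chain \<open>c\<close>. By locality the element of rank \<open>i\<close> of \<open>w c\<close> depends only on the
  subset \<open>S = w\<^sup>-\<^sup>1 {1..i}\<close>; call it \<open>T S\<close>. Thus \<open>T\<close> is an order- and rank-preserving map from the
  Boolean algebra to \<open>P\<close>, invariant under the stabilizer \<open>H\<close> of \<open>c\<close>. If \<open>T (X \<union> {a}) = T (X \<union> {b})\<close>,
  then two chains of the orbit agree in all ranks, so the transposition of \<open>a\<close> and \<open>b\<close> lies in \<open>H\<close>.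
  For \<open>X = {}\<close> this shows that \<open>h \<in> H\<close> implies \<open>(a h(a)) \<in> H\<close> for all \<open>a\<close>, hence \<open>H\<close> is a Young subgroup.

  Summing cycle types over a Young subgroup with blocks \<open>B\<close> gives \<open>\<Prod> |B|! h_|B|\<close>, so \<open>ch \<psi>\<close> is
  the sum over all maximal chains of \<open>\<Prod> |B|! / n!\<close> times \<open>\<Prod> h_|B|\<close>. If this equals \<open>h_\<nu>\<close>, comparing
  the coefficients of \<open>x_0^n\<close> shows that the action is transitive, and the blocks have sizes \<open>\<nu>\<close>.
  Then \<open>T S \<le> T S'\<close> holds iff \<open>|S \<inter> B| \<le> |S' \<inter> B|\<close> for all blocks, which is the product of chains.
\<close>

section \<open>Cycle types and complete homogeneous symmetric functions\<close>

text \<open>A chain \<open>m\<close> enters \<open>frob_ch\<close> with coefficient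
  \<open>card (St m) / n!\<close>, the reciprocal of its orbit size, so the coefficient of
  \<open>x_0^n\<close> counts orbits: this is why the value 1 means transitivity. Reading off the
  block sizes needs less than independence of the \<open>h_nu\<close>: once all chains have one
  shape, two single products are compared, and their values at \<open>(1, t, 0, ...)\<close>
  separate them, because \<open>h_k\<close> becomes \<open>1 + t + ... + t^k\<close> and the factors
  can be recovered from roots of unity. The harder half of the order criterion is that
  \<open>T S = T S'\<close> forces equal block counts. The transposition argument compares only sets
  that differ by one exchange, whereas \<open>S\<close> and \<open>S'\<close> are arbitrary. The way
  round is to splice the two maximal chains at the common element. Transitivity puts the splice back
  in the orbit, so it too comes from a flag of subsets; walking along the chains from the bottom or
  from the top, each comparison is a single exchange once an element of the stabilizer has aligned
  the sets.\<close>

lemma orbit_eq_of_mem: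
  assumes "p permutes A" "finite A" "y \<in> orbit p x"
  shows "orbit p y = orbit p x"
proof -
  have "permutation p" using assms permutation_permutes by blast
  then show ?thesis
    using assms(3) orbit_cyclic_eq3[OF cyclic_on_orbit'[OF \<open>permutation p\<close>]] by blast
qed

lemma partition_on_orbits:
  assumes "p permutes A" "finite A"
  shows "partition_on A (orbit p ` A)"
proof (rule partition_onI)
  have perm: "permutation p" using assms permutation_permutes by blast
  have sub: "orbit p x \<subseteq> A" if "x \<in> A" for x
    using permutes_orbit_subset[OF assms(1) that] .
  show "\<Union> (orbit p ` A) = A"
    using sub permutation_self_in_orbit[OF perm] by blast
  show "disjnt S T" if "S \<in> orbit p ` A" "T \<in> orbit p ` A" "S \<noteq> T" for S T
    using that orbit_eq_of_mem[OF assms] unfolding disjnt_def by (metis disjoint_iff imageE)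
  show "{} \<notin> orbit p ` A"
    using orbit_nonempty by (metis imageE)
qed

lemma prod_var_sp:
  assumes "finite A"
  shows "(\<Prod>x\<in>A. var_sp (f x)) = Poly_Mapping.single (\<Sum>x\<in>A. Poly_Mapping.single (f x) 1) 1"
  using assms by (induction A rule: finite_induct) (auto simp: var_sp_def mult_single)

lemma prod_partition_on:
  assumes "partition_on A C" "finite A"
  shows "(\<Prod>Z\<in>C. \<Prod>x\<in>Z. g x) = prod g A"
proof -
  have A: "A = \<Union>C" using partition_onD1[OF assms(1)] .
  have "\<forall>Z\<in>C. finite Z" using assms(2) A by (meson Sup_upper finite_subset)
  moreover have "\<forall>X\<in>C. \<forall>Y\<in>C. X \<noteq> Y \<longrightarrow> X \<inter> Y = {}"
    using partition_onD2[OF assms(1)] by (auto simp: disjoint_def)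
  ultimately show ?thesis unfolding A by (simp add: prod.Union_disjoint)
qed

text \<open>Expanding the product chooses one variable for each cycle, which is a colouring of
  \<open>A\<close> constant on the cycles of \<open>p\<close>, that is, a colouring fixed by
  \<open>p\<close>.\<close>

lemma prod_power_sum_cycles:
  assumes p: "p permutes A" and A: "finite A"
  shows "(\<Prod>Z\<in>orbit p ` A. power_sum n (card Z)) =
    (\<Sum>f\<in>{f\<in>A \<rightarrow>\<^sub>E {..<n}. \<forall>x\<in>A. f (p x) = f x}. \<Prod>x\<in>A. var_sp (f x))"
proof -
  let ?C = "orbit p ` A"
  let ?F = "{f\<in>A \<rightarrow>\<^sub>E {..<n}. \<forall>x\<in>A. f (p x) = f x}"
  have perm: "permutation p" using assms permutation_permutes by blast
  note part = partition_on_orbits[OF p A]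
  have self: "x \<in> orbit p x" for x using permutation_self_in_orbit[OF perm] .
  have sub: "orbit p x \<subseteq> A" if "x \<in> A" for x
    using permutes_orbit_subset[OF p that] .
  have const: "f y = f x" if "f \<in> ?F" "y \<in> orbit p x" "x \<in> A" for f x y
    using that(2)
  proof induction
    case base
    then show ?case using that by auto
  next
    case (step y)
    then have "y \<in> A" using sub that(3) by blast
    then show ?case using step that(1) by simp
  qed
  have "(\<Prod>Z\<in>?C. power_sum n (card Z)) = (\<Sum>g\<in>?C \<rightarrow>\<^sub>E {..<n}. \<Prod>Z\<in>?C. var_sp (g Z) ^ card Z)"
    unfolding power_sum_def using A by (subst prod_sum_PiE) auto
  also have "\<dots> = (\<Sum>f\<in>?F. \<Prod>x\<in>A. var_sp (f x))"
  \<comment> \<open>A choice \<open>g\<close> for the cycles is pulled back along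
    \<open>orbit p\<close>; conversely a \<open>p\<close>-invariant \<open>f\<close> is evaluated at
    an arbitrary representative of each cycle.\<close>
  proof (rule sum.reindex_bij_witness[where
        j = "\<lambda>g. restrict (\<lambda>x. g (orbit p x)) A" and
        i = "\<lambda>f. restrict (\<lambda>Z. f (SOME x. x \<in> Z)) ?C"])
    fix g assume g: "g \<in> ?C \<rightarrow>\<^sub>E {..<n}"
    have o: "orbit p (SOME x. x \<in> orbit p y) = orbit p y" for y
      using orbit_eq_of_mem[OF p A] someI[of "\<lambda>x. x \<in> orbit p y", OF self] by blast
    show "restrict (\<lambda>Z. restrict (\<lambda>x. g (orbit p x)) A (SOME x. x \<in> Z)) ?C = g"
    proof
      fix Z show "restrict (\<lambda>Z. restrict (\<lambda>x. g (orbit p x)) A (SOME x. x \<in> Z)) ?C Z = g Z"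
      proof (cases "Z \<in> ?C")
        case True
        then obtain y where y: "Z = orbit p y" "y \<in> A" by auto
        have "(SOME x. x \<in> Z) \<in> A"
          using someI[of "\<lambda>x. x \<in> Z" y] self y sub by blast
        then show ?thesis using True y o by simp
      next
        case False
        then show ?thesis using PiE_arb[OF g False] by simp
      qed
    qed
    have inv: "orbit p (p x) = orbit p x" for x
      using orbit_eq_of_mem[OF p A orbit.base] .
    show "restrict (\<lambda>x. g (orbit p x)) A \<in> ?F"
      using g p by (auto simp: permutes_in_image inv)
    have "(\<Prod>x\<in>A. var_sp (restrict (\<lambda>x. g (orbit p x)) A x)) = (\<Prod>x\<in>A. var_sp (g (orbit p x)))"
      by (rule prod.cong) auto
    also have "\<dots> = (\<Prod>Z\<in>?C. \<Prod>x\<in>Z. var_sp (g (orbit p x)))"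
      using prod_partition_on[OF part A, of "\<lambda>x. var_sp (g (orbit p x))"] by simp
    also have "\<dots> = (\<Prod>Z\<in>?C. var_sp (g Z) ^ card Z)"
    proof (rule prod.cong)
      fix Z assume "Z \<in> ?C"
      then have "orbit p x = Z" if "x \<in> Z" for x
        using that orbit_eq_of_mem[OF p A] by blast
      then show "(\<Prod>x\<in>Z. var_sp (g (orbit p x))) = var_sp (g Z) ^ card Z"
        by simp
    qed simp
    finally show "(\<Prod>x\<in>A. var_sp (restrict (\<lambda>x. g (orbit p x)) A x)) = (\<Prod>Z\<in>?C. var_sp (g Z) ^ card Z)" .
  next
    fix f assume f: "f \<in> ?F"
    have *: "f (SOME x. x \<in> orbit p y) = f y" if "y \<in> A" for y
      using const[OF f _ that] someI[of "\<lambda>x. x \<in> orbit p y", OF self] by blast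
    show "restrict (\<lambda>x. restrict (\<lambda>Z. f (SOME x. x \<in> Z)) ?C (orbit p x)) A = f"
    proof
      fix x
      have fA: "f \<in> A \<rightarrow>\<^sub>E {..<n}" using f by simp
      show "restrict (\<lambda>x. restrict (\<lambda>Z. f (SOME x. x \<in> Z)) ?C (orbit p x)) A x = f x"
        using * PiE_arb[OF fA] by (cases "x \<in> A") auto
    qed
    show "restrict (\<lambda>Z. f (SOME x. x \<in> Z)) ?C \<in> ?C \<rightarrow>\<^sub>E {..<n}"
      using f * by auto
  qed
  finally show ?thesis .
qed

section \<open>Colourings of a finite set and their exponent vectors (contents)\<close>

lemma lookup_content:
  assumes "finite A"
  shows "Poly_Mapping.lookup (\<Sum>x\<in>A. Poly_Mapping.single (f x) (1::nat)) i = card {x\<in>A. f x = i}"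
  using assms
  by (simp add: lookup_sum lookup_single when_def sum.If_cases Collect_conj_eq)

lemma sum_lookup_content:
  assumes "finite A" "f ` A \<subseteq> {..<n::nat}"
  shows "(\<Sum>i<n. Poly_Mapping.lookup (\<Sum>x\<in>A. Poly_Mapping.single (f x) (1::nat)) i) = card A"
proof -
  have "A = (\<Union>i\<in>{..<n}. {x\<in>A. f x = i})" using assms by auto
  then have "card A = card (\<Union>i\<in>{..<n}. {x\<in>A. f x = i})" by simp
  also have "\<dots> = (\<Sum>i<n. card {x\<in>A. f x = i})"
    by (rule card_UN_disjoint) (use assms in auto)
  finally show ?thesis unfolding lookup_content[OF assms(1)] by simp
qed

lemma exists_content:
  assumes "finite A" "Poly_Mapping.keys \<alpha> \<subseteq> {..<n::nat}"
    "(\<Sum>i<n. Poly_Mapping.lookup \<alpha> i) = card A"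
  shows "\<exists>f\<in>A \<rightarrow>\<^sub>E {..<n}. (\<Sum>x\<in>A. Poly_Mapping.single (f x) (1::nat)) = \<alpha>"
  using assms
proof (induction A arbitrary: \<alpha> rule: finite_induct)
  case empty
  then have "\<alpha> = 0"
    by (intro poly_mapping_eqI) (metis card.empty finite_lessThan in_keys_iff lookup_zero subsetD sum_eq_0_iff)
  then show ?case by auto
next
  case (insert a A)
  from insert.prems(2) insert.hyps have "(\<Sum>i<n. Poly_Mapping.lookup \<alpha> i) \<noteq> 0" by simp
  then obtain j where j: "j < n" "Poly_Mapping.lookup \<alpha> j \<noteq> 0"
    by (meson lessThan_iff sum.neutral)
  \<comment> \<open>Subtraction of exponents is truncated; \<open>j\<close> has nonzero exponent in
    \<open>\<alpha>\<close>, so adding it back restores \<open>\<alpha>\<close>. The colour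
    \<open>j\<close> is then given to the new point \<open>a\<close>.\<close>
  define \<beta> where "\<beta> = \<alpha> - Poly_Mapping.single j 1"
  have ab: "\<alpha> = \<beta> + Poly_Mapping.single j 1"
    using j unfolding \<beta>_def by (intro poly_mapping_eqI) (auto simp: lookup_add lookup_minus lookup_single when_def)
  have k: "Poly_Mapping.keys \<beta> \<subseteq> {..<n}"
  proof
    fix i assume "i \<in> Poly_Mapping.keys \<beta>"
    then have "i \<in> Poly_Mapping.keys \<alpha>" by (auto simp: \<beta>_def in_keys_iff lookup_minus simp del: One_nat_def)
    then show "i \<in> {..<n}" using insert.prems(1) by auto
  qed
  have "(\<Sum>i<n. Poly_Mapping.lookup \<alpha> i) = (\<Sum>i<n. Poly_Mapping.lookup \<beta> i) + (\<Sum>i<n. Poly_Mapping.lookup (Poly_Mapping.single j 1) i)"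
    unfolding sum.distrib[symmetric] by (intro sum.cong refl) (simp add: ab lookup_add)
  moreover have "(\<Sum>i<n. Poly_Mapping.lookup (Poly_Mapping.single j (1::nat)) i) = 1"
    using j by (simp add: lookup_single when_def)
  ultimately have "(\<Sum>i<n. Poly_Mapping.lookup \<beta> i) = card A"
    using insert.prems(2) insert.hyps by simp
  from insert.IH[OF k this] obtain f where f: "f \<in> A \<rightarrow>\<^sub>E {..<n}"
    "(\<Sum>x\<in>A. Poly_Mapping.single (f x) (1::nat)) = \<beta>" by auto
  have "(\<Sum>x\<in>insert a A. Poly_Mapping.single ((f(a:=j)) x) (1::nat)) = Poly_Mapping.single j 1 + (\<Sum>x\<in>A. Poly_Mapping.single ((f(a:=j)) x) 1)"
    using insert.hyps by simp
  also have "(\<Sum>x\<in>A. Poly_Mapping.single ((f(a:=j)) x) (1::nat)) = (\<Sum>x\<in>A. Poly_Mapping.single (f x) 1)"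
    using insert.hyps by (intro sum.cong) auto
  finally have "(\<Sum>x\<in>insert a A. Poly_Mapping.single ((f(a:=j)) x) (1::nat)) = \<alpha>"
    using f ab by (metis add.commute)
  moreover have "f(a:=j) \<in> insert a A \<rightarrow>\<^sub>E {..<n}"
    using f j by (auto simp: PiE_iff extensional_def)
  ultimately show ?case by blast
qed

text \<open>Identifies the index set of \<open>complete_h\<close> with the contents of colourings,
  so that sums over colourings can be grouped by monomial.\<close>

lemma contents_eq:
  assumes A: "finite A"
  shows "(\<lambda>f. \<Sum>x\<in>A. Poly_Mapping.single (f x :: nat) (1::nat)) ` (A \<rightarrow>\<^sub>E {..<n}) =
    {\<alpha>. Poly_Mapping.keys \<alpha> \<subseteq> {..<n} \<and> (\<Sum>i<n. Poly_Mapping.lookup \<alpha> i) = card A}"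
    (is "?c ` ?E = ?K")
proof (intro equalityI subsetI)
  fix \<alpha> assume "\<alpha> \<in> ?c ` ?E"
  then obtain f where f: "f \<in> ?E" "\<alpha> = ?c f" by auto
  have "f ` A \<subseteq> {..<n}" using f by auto
  moreover have "Poly_Mapping.keys (?c f) \<subseteq> {..<n}"
    using keys_sum[of "\<lambda>x. Poly_Mapping.single (f x) (1::nat)" A] f by fastforce
  ultimately show "\<alpha> \<in> ?K" using f sum_lookup_content[OF A, of f n] by auto
next
  fix \<alpha> assume "\<alpha> \<in> ?K" then show "\<alpha> \<in> ?c ` ?E" using exists_content[OF A, of \<alpha> n] by auto
qed

lemma finite_contents:
  fixes n :: nat
  shows "finite {\<alpha>. Poly_Mapping.keys \<alpha> \<subseteq> {..<n} \<and> (\<Sum>i<n. Poly_Mapping.lookup \<alpha> i) = (k::nat)}"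
proof -
  have "finite ((\<lambda>f. \<Sum>x\<in>{..<k}. Poly_Mapping.single (f x :: nat) (1::nat)) ` ({..<k} \<rightarrow>\<^sub>E {..<n}))"
    by (intro finite_imageI finite_PiE) auto
  then show ?thesis by (simp only: contents_eq[OF finite_lessThan] card_lessThan)
qed

text \<open>Equal contents are equal multisets of colours, and such colourings differ by a
  permutation of the points.\<close>

lemma same_content_permutes:
  assumes "finite A"
    "(\<Sum>x\<in>A. Poly_Mapping.single (f x) (1::nat)) = (\<Sum>x\<in>A. Poly_Mapping.single (g x) (1::nat))"
  obtains p where "p permutes A" "\<forall>x\<in>A. f x = g (p x)"
proof -
  have "image_mset f (mset_set A) = image_mset g (mset_set A)"
  proof (rule multiset_eqI)
    fix i
    show "count (image_mset f (mset_set A)) i = count (image_mset g (mset_set A)) i"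
      using lookup_content[OF assms(1), of f i] lookup_content[OF assms(1), of g i] assms(2)
      by (simp only: count_image_mset_eq_card_vimage[OF assms(1)])
  qed
  from image_mset_eq_implies_permutes[OF assms(1) this] that show ?thesis by blast
qed

text \<open>The permutations fixing \<open>f\<close> are, up to a coset, those carrying \<open>f\<close> to a fixed \<open>f0\<close> of the
  same content; and every permutation carries exactly one \<open>f\<close> to \<open>f0\<close>.\<close>

lemma sum_card_stabilizers_content:
  assumes A: "finite A" and k: "Poly_Mapping.keys \<alpha> \<subseteq> {..<n::nat}"
    and s: "(\<Sum>i<n. Poly_Mapping.lookup \<alpha> i) = card A"
  shows "(\<Sum>f | f \<in> A \<rightarrow>\<^sub>E {..<n} \<and> (\<Sum>x\<in>A. Poly_Mapping.single (f x) (1::nat)) = \<alpha>.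
    card {p. p permutes A \<and> (\<forall>x\<in>A. f (p x) = f x)}) = fact (card A)"
proof -
  let ?F = "{f. f \<in> A \<rightarrow>\<^sub>E {..<n} \<and> (\<Sum>x\<in>A. Poly_Mapping.single (f x) (1::nat)) = \<alpha>}"
  obtain f0 where f0: "f0 \<in> ?F" using exists_content[OF A k s] by auto
  let ?G = "\<lambda>f. {p. p permutes A \<and> (\<forall>x\<in>A. f0 (p x) = f x)}"
  have "finite (A \<rightarrow>\<^sub>E {..<n})" using A by (intro finite_PiE) auto
  then have F: "finite ?F" by (auto intro: finite_subset)
  have eq: "card {p. p permutes A \<and> (\<forall>x\<in>A. f (p x) = f x)} = card (?G f)" if "f \<in> ?F" for f
  proof -
    from that f0 obtain q where q: "q permutes A" "\<forall>x\<in>A. f x = f0 (q x)"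
      using same_content_permutes[OF A, of f f0] by auto
    \<comment> \<open>Since \<open>f = f0 \<circ> q\<close> on \<open>A\<close>, the condition
      \<open>f \<circ> p = f\<close> reads \<open>f0 \<circ> (q \<circ> p) = f\<close>.\<close>
    have "bij_betw (\<lambda>p. q \<circ> p) {p. p permutes A \<and> (\<forall>x\<in>A. f (p x) = f x)} (?G f)"
    proof (rule bij_betw_byWitness[where f' = "\<lambda>p. inv q \<circ> p"])
      show "(\<lambda>p. q \<circ> p) ` {p. p permutes A \<and> (\<forall>x\<in>A. f (p x) = f x)} \<subseteq> ?G f"
        using q by (auto intro: permutes_compose simp: permutes_in_image)
      have "f (inv q y) = f0 y" if "y \<in> A" for y
        using q that by (metis permutes_inv permutes_in_image permutes_inverses(1))
      then show "(\<lambda>p. inv q \<circ> p) ` ?G f \<subseteq> {p. p permutes A \<and> (\<forall>x\<in>A. f (p x) = f x)}"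
        using q by (auto intro!: permutes_compose permutes_inv simp: permutes_in_image)
    qed (use q in \<open>auto simp: fun_eq_iff permutes_inverses\<close>)
    then show ?thesis by (rule bij_betw_same_card)
  qed
  have "(\<Sum>f\<in>?F. card {p. p permutes A \<and> (\<forall>x\<in>A. f (p x) = f x)}) = (\<Sum>f\<in>?F. card (?G f))"
    by (rule sum.cong) (use eq in auto)
  also have "\<dots> = card (\<Union>f\<in>?F. ?G f)"
  proof (rule card_UN_disjoint[symmetric])
    show "\<forall>f\<in>?F. finite (?G f)" using finite_permutations[OF A] by auto
    show "\<forall>f\<in>?F. \<forall>g\<in>?F. f \<noteq> g \<longrightarrow> ?G f \<inter> ?G g = {}"
    proof (intro ballI impI equals0I)
      fix f g p assume fg: "f \<in> ?F" "g \<in> ?F" "f \<noteq> g" "p \<in> ?G f \<inter> ?G g"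
      then have "f \<in> extensional A" "g \<in> extensional A" by (auto simp: PiE_iff)
      then have "f = g" using fg(4) by (auto intro: extensionalityI)
      then show False using fg(3) by blast
    qed
  qed (use F in auto)
  also have "(\<Union>f\<in>?F. ?G f) = {p. p permutes A}"
  proof (intro equalityI subsetI)
    fix p assume "p \<in> {p. p permutes A}"
    then have p: "p permutes A" by simp
    let ?f = "restrict (\<lambda>x. f0 (p x)) A"
    have "?f \<in> A \<rightarrow>\<^sub>E {..<n}" using f0 p by (auto simp: permutes_in_image)
    moreover have "(\<Sum>x\<in>A. Poly_Mapping.single (?f x) (1::nat)) = (\<Sum>x\<in>A. Poly_Mapping.single (f0 (p x)) 1)"
      by (rule sum.cong) auto
    moreover have "\<dots> = (\<Sum>x\<in>A. Poly_Mapping.single (f0 x) 1)"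
      using sum.permute[OF p, of "\<lambda>x. Poly_Mapping.single (f0 x) (1::nat)"] by (simp only: o_def)
    ultimately have "?f \<in> ?F" using f0 by auto
    moreover have "p \<in> ?G ?f" using p by auto
    ultimately show "p \<in> (\<Union>f\<in>?F. ?G f)" by blast
  qed auto
  finally show ?thesis using card_permutations[OF refl A] by simp
qed

text \<open>A Burnside double count of pairs of a permutation and a colouring fixed by it: summed
  over the colourings first it gives cycle types, summed over the permutations first it gives each
  monomial with multiplicity \<open>fact (card A)\<close>.\<close>

lemma sum_permutations_cycles:
  assumes A: "finite A"
  shows "(\<Sum>p | p permutes A. \<Prod>Z\<in>orbit p ` A. power_sum n (card Z)) =
    of_nat (fact (card A)) * complete_h n (card A)"
proof -
  let ?P = "{p. p permutes A}" and ?E = "A \<rightarrow>\<^sub>E {..<n}"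
  let ?c = "\<lambda>f. \<Sum>x\<in>A. Poly_Mapping.single (f x) (1::nat)"
  let ?M = "\<lambda>f. Poly_Mapping.single (?c f) (1::real)"
  let ?K = "{\<alpha>. Poly_Mapping.keys \<alpha> \<subseteq> {..<n} \<and> (\<Sum>i<n. Poly_Mapping.lookup \<alpha> i) = card A}"
  let ?st = "\<lambda>f. {p. p permutes A \<and> (\<forall>x\<in>A. f (p x) = f x)}"
  have E: "finite ?E" using A by (intro finite_PiE) auto
  have P: "finite ?P" using finite_permutations[OF A] .
  note cK = contents_eq[OF A, of n]
  have "(\<Sum>p\<in>?P. \<Prod>Z\<in>orbit p ` A. power_sum n (card Z)) =
    (\<Sum>p\<in>?P. \<Sum>f | f \<in> ?E \<and> (\<forall>x\<in>A. f (p x) = f x). ?M f)"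
    using A by (intro sum.cong) (auto simp: prod_power_sum_cycles prod_var_sp)
  also have "\<dots> = (\<Sum>f\<in>?E. \<Sum>p | p \<in> ?P \<and> (\<forall>x\<in>A. f (p x) = f x). ?M f)"
    by (rule sum.swap_restrict[OF P E])
  also have "\<dots> = (\<Sum>f\<in>?E. of_nat (card (?st f)) * ?M f)"
    by (intro sum.cong) auto
  also have "\<dots> = (\<Sum>\<alpha>\<in>?K. \<Sum>f | f \<in> ?E \<and> ?c f = \<alpha>. of_nat (card (?st f)) * ?M f)"
    unfolding cK[symmetric] by (rule sum.image_gen[OF E])
  also have "\<dots> = (\<Sum>\<alpha>\<in>?K. of_nat (\<Sum>f | f \<in> ?E \<and> ?c f = \<alpha>. card (?st f)) * Poly_Mapping.single \<alpha> 1)"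
    by (auto intro!: sum.cong simp: sum_distrib_right)
  also have "\<dots> = (\<Sum>\<alpha>\<in>?K. of_nat (fact (card A)) * Poly_Mapping.single \<alpha> 1)"
    by (intro sum.cong refl) (use sum_card_stabilizers_content[OF A] in auto)
  finally show ?thesis by (simp add: complete_h_def sum_distrib_left)
qed

section \<open>Young subgroups and the Frobenius characteristic\<close>

text \<open>Replaces the existential family of block permutations by invariance of the blocks.
  Inclusion suffices, because an injective self-map of a finite block is onto.\<close>

lemma young_subgroup_iff:
  assumes Bs: "partition_on {1..n} Bs"
  shows "p \<in> young_subgroup n Bs \<longleftrightarrow> p \<in> Sym n \<and> (\<forall>B\<in>Bs. p ` B \<subseteq> B)"
proof
  assume "p \<in> young_subgroup n Bs"
  then obtain f where p: "p \<in> Sym n" and f: "\<And>B. B \<in> Bs \<Longrightarrow> f B \<in> Sym_on n B"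
    and pf: "\<And>B x. B \<in> Bs \<Longrightarrow> x \<in> B \<Longrightarrow> p x = f B x"
    unfolding young_subgroup_def by auto
  have "p ` B \<subseteq> B" if B: "B \<in> Bs" for B
  proof
    fix y assume "y \<in> p ` B"
    then obtain x where x: "x \<in> B" "y = f B x" using pf[OF B] by auto
    have inj: "inj (f B)" using f[OF B] by (auto simp: Sym_on_def Sym_def intro: permutes_inj)
    show "y \<in> B"
    proof (rule ccontr)
      assume "y \<notin> B"
      then have "f B y = y" using f[OF B] by (auto simp: Sym_on_def)
      then have "y = x" using x inj by (metis injD)
      then show False using x \<open>y \<notin> B\<close> by simp
    qed
  qed
  then show "p \<in> Sym n \<and> (\<forall>B\<in>Bs. p ` B \<subseteq> B)" using p by blast
next
  assume p: "p \<in> Sym n \<and> (\<forall>B\<in>Bs. p ` B \<subseteq> B)"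
  define f where "f B = (\<lambda>x. if x \<in> B then p x else x)" for B
  have inj: "inj p" using p by (auto simp: Sym_def intro: permutes_inj)
  have "f B \<in> Sym_on n B" if B: "B \<in> Bs" for B
  proof -
    have sub: "B \<subseteq> {1..n}" using partition_onD1[OF Bs] B by blast
    then have "finite B" using finite_subset by blast
    then have "bij_betw p B B"
      using p B inj by (metis bij_betw_def endo_inj_surj inj_on_subset subset_UNIV)
    then have "bij_betw (f B) B B"
      using bij_betw_cong[of B "f B" p B] by (simp add: f_def)
    then have "f B permutes B" by (rule bij_imp_permutes) (simp add: f_def)
    then show ?thesis
      using permutes_subset[OF _ sub] by (auto simp: Sym_on_def Sym_def f_def)
  qed
  moreover have "p x = x" if "x \<notin> \<Union>Bs" for x
    using p that partition_onD1[OF Bs] by (auto simp: Sym_def permutes_def)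
  ultimately show "p \<in> young_subgroup n Bs"
    unfolding young_subgroup_def using p by (auto intro!: exI[of _ f] simp: f_def)
qed

text \<open>Invariance of the blocks keeps every orbit inside one block, so the cycles split into
  disjoint families indexed by the blocks.\<close>

lemma power_sum_type_partition:
  assumes Bs: "partition_on {1..n} Bs" and p: "p \<in> young_subgroup n Bs"
  shows "power_sum_type n p = (\<Prod>B\<in>Bs. \<Prod>Z\<in>orbit p ` B. power_sum n (card Z))"
proof -
  have U: "{1..n} = \<Union>Bs" using partition_onD1[OF Bs] .
  have fin: "finite Bs" using finite_elements[OF _ Bs] by simp
  have finB: "finite B" if "B \<in> Bs" for B using that U by (metis Sup_upper finite_atLeastAtMost finite_subset)
  have pB: "p ` B \<subseteq> B" if "B \<in> Bs" for B using p young_subgroup_iff[OF Bs] that by blast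
  have sub: "orbit p x \<subseteq> B" if "B \<in> Bs" "x \<in> B" for B x
  proof
    fix y assume "y \<in> orbit p x"
    then show "y \<in> B" by induction (use that pB in blast)+
  qed
  have "cycles_of n p = (\<Union>B\<in>Bs. orbit p ` B)"
    unfolding cycles_of_def U by auto
  then have "power_sum_type n p = (\<Prod>Z\<in>(\<Union>B\<in>Bs. orbit p ` B). power_sum n (card Z))"
    unfolding power_sum_type_def by simp
  also have "\<dots> = (\<Prod>B\<in>Bs. \<Prod>Z\<in>orbit p ` B. power_sum n (card Z))"
  proof (rule prod.UNION_disjoint)
    show "\<forall>B\<in>Bs. \<forall>C\<in>Bs. B \<noteq> C \<longrightarrow> orbit p ` B \<inter> orbit p ` C = {}"
    proof (intro ballI impI equals0I)
      fix B C Z assume BC: "B \<in> Bs" "C \<in> Bs" "B \<noteq> C" "Z \<in> orbit p ` B \<inter> orbit p ` C"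
      then obtain x where x: "x \<in> B" "Z = orbit p x" by blast
      have "Z \<subseteq> B" using x sub BC(1) by blast
      moreover have "Z \<subseteq> C" using BC(2,4) sub by blast
      moreover have "Z \<noteq> {}" using x orbit_nonempty by metis
      moreover have "B \<inter> C = {}" using disjointD[OF partition_onD2[OF Bs] BC(1-3)] .
      ultimately show False by blast
    qed
  qed (use fin finB in auto)
  finally show ?thesis .
qed

text \<open>Each restriction is extended by the identity, so that it satisfies
  \<open>permutes B\<close>; the outer \<open>restrict\<close> makes the family extensional, as
  membership in \<open>PiE\<close> requires.\<close>

definition block_restrictions :: "nat set set \<Rightarrow> (nat \<Rightarrow> nat) \<Rightarrow> nat set \<Rightarrow> nat \<Rightarrow> nat" where
  "block_restrictions Bs p = restrict (\<lambda>B x. if x \<in> B then p x else x) Bs"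

lemma bij_betw_block_restrictions:
  assumes Bs: "partition_on {1..n} Bs"
  shows "bij_betw (block_restrictions Bs) (young_subgroup n Bs) (PiE Bs (\<lambda>B. {q. q permutes B}))"
proof -
  have U: "{1..n} = \<Union>Bs" using partition_onD1[OF Bs] .
  have finB: "finite B" if "B \<in> Bs" for B using that U by (metis Sup_upper finite_atLeastAtMost finite_subset)
  let ?G = "PiE Bs (\<lambda>B. {q. q permutes B})"
  let ?j = "block_restrictions Bs"
  \<comment> \<open>The block of \<open>x\<close> is unique by disjointness. The inverse map
    \<open>i\<close> glues a family by applying to \<open>x\<close> the permutation of its block,
    and fixes everything outside \<open>{1..n}\<close>.\<close>
  define bl where "bl x = (THE B. B \<in> Bs \<and> x \<in> B)" for x
  have bl: "bl x = B" if "B \<in> Bs" "x \<in> B" for x B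
    unfolding bl_def using that partition_onD2[OF Bs] by (auto intro!: the_equality dest: disjointD)
  define i where "i g x = (if x \<in> {1..n} then g (bl x) x else x)" for g :: "nat set \<Rightarrow> nat \<Rightarrow> nat" and x
  show ?thesis
  proof (rule bij_betw_byWitness[where f' = i])
    show "\<forall>p\<in>young_subgroup n Bs. i (?j p) = p"
    proof (intro ballI ext)
      fix p x assume "p \<in> young_subgroup n Bs"
      then have pn: "p permutes {1..n}" using young_subgroup_iff[OF Bs] by (auto simp: Sym_def)
      show "i (?j p) x = p x"
      proof (cases "x \<in> {1..n}")
        case True
        then obtain B where "B \<in> Bs" "x \<in> B" unfolding U by blast
        then show ?thesis using True by (simp add: i_def block_restrictions_def bl)
      next
        case False
        then show ?thesis using permutes_not_in[OF pn False] by (auto simp: i_def)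
      qed
    qed
    show "?j ` young_subgroup n Bs \<subseteq> ?G"
    proof
      fix g assume "g \<in> ?j ` young_subgroup n Bs"
      then obtain p where p: "p \<in> young_subgroup n Bs" "g = ?j p" by blast
      then have pn: "p permutes {1..n}" and pB: "\<And>B. B \<in> Bs \<Longrightarrow> p ` B \<subseteq> B"
        using young_subgroup_iff[OF Bs] by (auto simp: Sym_def)
      have "g B permutes B" if B: "B \<in> Bs" for B
      proof -
        have "bij_betw p B B"
          using pB[OF B] permutes_inj[OF pn] finB[OF B]
          by (metis bij_betw_def endo_inj_surj inj_on_subset subset_UNIV)
        then have "bij_betw (g B) B B"
          using bij_betw_cong[of B "g B" p B] B p(2) by (simp add: block_restrictions_def)
        then show ?thesis by (rule bij_imp_permutes) (simp add: p(2) block_restrictions_def B)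
      qed
      then show "g \<in> ?G" unfolding p(2) by (auto simp: block_restrictions_def)
    qed
    have gB: "g B permutes B" if "g \<in> ?G" "B \<in> Bs" for g B using that by auto
    have iB: "i g x = g B x" if "B \<in> Bs" "x \<in> B" for g B x
      using that U by (auto simp: i_def bl)
    show "\<forall>g\<in>?G. ?j (i g) = g"
    proof (intro ballI ext)
      fix g B x assume g: "g \<in> ?G"
      show "?j (i g) B x = g B x"
      proof (cases "B \<in> Bs")
        case True
        then show ?thesis
          using iB[OF True] permutes_not_in[OF gB[OF g True]] by (auto simp: block_restrictions_def)
      next
        case False
        then show ?thesis using PiE_arb[OF g False] by (simp add: block_restrictions_def)
      qed
    qed
    show "i ` ?G \<subseteq> young_subgroup n Bs"
    proof
      fix p assume "p \<in> i ` ?G"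
      then obtain g where g: "g \<in> ?G" "p = i g" by blast
      have im: "i g ` B = B" if "B \<in> Bs" for B
        using iB[OF that] permutes_image[OF gB[OF g(1) that]] by (metis image_cong)
      have "i g ` {1..n} = {1..n}" unfolding U image_Union using im by auto
      then have "bij_betw (i g) {1..n} {1..n}"
        by (metis bij_betw_def eq_card_imp_inj_on finite_atLeastAtMost)
      then have "i g permutes {1..n}" by (rule bij_imp_permutes) (auto simp: i_def)
      then show "p \<in> young_subgroup n Bs"
        using im by (simp add: young_subgroup_iff[OF Bs] Sym_def g(2))
    qed
  qed
qed

lemma card_young_subgroup:
  assumes Bs: "partition_on {1..n} Bs"
  shows "card (young_subgroup n Bs) = (\<Prod>B\<in>Bs. fact (card B))"
proof -
  have fin: "finite Bs" using finite_elements[OF _ Bs] by simp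
  have finB: "finite B" if "B \<in> Bs" for B
    using that partition_onD1[OF Bs] by (metis Sup_upper finite_atLeastAtMost finite_subset)
  show ?thesis
    using bij_betw_same_card[OF bij_betw_block_restrictions[OF Bs]] finB
    by (simp add: card_PiE[OF fin] card_permutations[OF refl])
qed

text \<open>In terms of families of block permutations, both the index set and the cycle weight are
  products over the blocks. Hence the sum factors, and each factor is an instance of
  \<open>sum_permutations_cycles\<close>.\<close>

lemma sum_young_subgroup:
  assumes Bs: "partition_on {1..n} Bs"
  shows "(\<Sum>p\<in>young_subgroup n Bs. power_sum_type n p) =
    of_nat (\<Prod>B\<in>Bs. fact (card B)) * (\<Prod>B\<in>Bs. complete_h n (card B))"
proof -
  have fin: "finite Bs" using finite_elements[OF _ Bs] by simp
  have finB: "finite B" if "B \<in> Bs" for B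
    using that partition_onD1[OF Bs] by (metis Sup_upper finite_atLeastAtMost finite_subset)
  let ?j = "block_restrictions Bs"
  let ?w = "\<lambda>g. \<Prod>B\<in>Bs. \<Prod>Z\<in>orbit (g B) ` B. power_sum n (card Z)"
  have "(\<Sum>p\<in>young_subgroup n Bs. power_sum_type n p) = (\<Sum>p\<in>young_subgroup n Bs. ?w (?j p))"
  proof (rule sum.cong)
    fix p assume p: "p \<in> young_subgroup n Bs"
    have jB: "?j p B permutes B" if "B \<in> Bs" for B
      using bij_betw_apply[OF bij_betw_block_restrictions[OF Bs] p] that by auto
    have "orbit (?j p B) x = orbit p x" if "B \<in> Bs" "x \<in> B" for B x
    proof (rule orbit_cong0[OF that(2)])
      show "?j p B \<in> B \<rightarrow> B" using permutes_in_image[OF jB[OF that(1)]] by blast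
      show "?j p B y = p y" if "y \<in> B" for y using that \<open>B \<in> Bs\<close> by (simp add: block_restrictions_def)
    qed
    then have "orbit (?j p B) ` B = orbit p ` B" if "B \<in> Bs" for B using that by force
    then show "power_sum_type n p = ?w (?j p)"
      by (simp add: power_sum_type_partition[OF Bs p])
  qed simp
  also have "\<dots> = (\<Sum>g\<in>PiE Bs (\<lambda>B. {q. q permutes B}). ?w g)"
    by (rule sum.reindex_bij_betw[OF bij_betw_block_restrictions[OF Bs]])
  also have "\<dots> = (\<Prod>B\<in>Bs. \<Sum>q | q permutes B. \<Prod>Z\<in>orbit q ` B. power_sum n (card Z))"
    by (rule prod_sum_PiE[symmetric]) (use fin finB finite_permutations in auto)
  also have "\<dots> = (\<Prod>B\<in>Bs. of_nat (fact (card B)) * complete_h n (card B))"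
    by (intro prod.cong refl) (use sum_permutations_cycles finB in auto)
  finally show ?thesis by (simp add: prod.distrib)
qed

section \<open>Constants, block shapes and the expansion of the characteristic\<close>

lemma const_sp_add: "const_sp (a + b) = const_sp a + const_sp b"
  by (simp add: const_sp_def single_add)

lemma const_sp_mult: "const_sp (a * b) = const_sp a * const_sp b"
  by (simp add: const_sp_def mult_single)

lemma const_sp_sum: "const_sp (sum f A) = (\<Sum>x\<in>A. const_sp (f x))"
  by (induction A rule: infinite_finite_induct) (auto simp: const_sp_add, simp_all add: const_sp_def)

lemma const_sp_of_nat: "const_sp (of_nat k) = of_nat k"
  by (induction k) (auto simp: const_sp_add, simp_all add: const_sp_def)

text \<open>The multiset keeps repeated block sizes; \<open>rev\<close> gives the weakly decreasing
  order demanded by \<open>int_partitions\<close>.\<close>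

definition shape :: "nat set set \<Rightarrow> nat list" where
  "shape Bs = rev (sorted_list_of_multiset (image_mset card (mset_set Bs)))"

lemma mset_shape: "mset (shape Bs) = image_mset card (mset_set Bs)"
  by (simp add: shape_def)

lemma shape_in_int_partitions:
  assumes Bs: "partition_on {1..n} Bs"
  shows "shape Bs \<in> int_partitions n"
proof -
  have U: "{1..n} = \<Union>Bs" using partition_onD1[OF Bs] .
  have fin: "finite Bs" using finite_elements[OF _ Bs] by simp
  have finB: "finite B" if "B \<in> Bs" for B using that U by (metis Sup_upper finite_atLeastAtMost finite_subset)
  have "sorted_wrt (\<ge>) (shape Bs)"
    unfolding shape_def sorted_wrt_rev
    using sorted_sorted_list_of_multiset[of "image_mset card (mset_set Bs)"] by simp
  moreover have "0 \<notin> set (shape Bs)"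
  proof
    assume "0 \<in> set (shape Bs)"
    then have "0 \<in># mset (shape Bs)" by simp
    then have "0 \<in># image_mset card (mset_set Bs)" unfolding mset_shape .
    then obtain B where "B \<in> Bs" "card B = 0" using fin by auto
    then show False using finB partition_onD3[OF Bs] by auto
  qed
  moreover have "sum_list (shape Bs) = n"
  proof -
    have "sum_list (shape Bs) = sum_mset (mset (shape Bs))" by (simp add: sum_mset_sum_list)
    also have "\<dots> = (\<Sum>B\<in>Bs. card B)" by (simp add: mset_shape sum_unfold_sum_mset)
    also have "\<dots> = card (\<Union>Bs)"
      using card_Union_disjoint[of Bs] finB partition_onD2[OF Bs]
      by (simp add: disjoint_def pairwise_def disjnt_def)
    finally show ?thesis using U by (metis card_atLeastAtMost diff_Suc_1)
  qed
  ultimately show ?thesis by (simp add: int_partitions_def)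
qed

lemma h_nu_shape: "h_nu n (shape Bs) = (\<Prod>B\<in>Bs. complete_h n (card B))"
proof -
  have "h_nu n (shape Bs) = prod_mset (image_mset (complete_h n) (mset (shape Bs)))"
    unfolding h_nu_def by (metis mset_map prod_mset_prod_list)
  then show ?thesis by (simp add: mset_shape prod_unfold_prod_mset image_mset.compositionality o_def)
qed

lemma finite_int_partitions: "finite (int_partitions n)"
proof (rule finite_subset)
  show "int_partitions n \<subseteq> {xs. set xs \<subseteq> {..n} \<and> length xs \<le> n}"
  proof (intro subsetI CollectI conjI)
    fix xs assume xs: "xs \<in> int_partitions n"
    then have s: "sum_list xs = n" and z: "0 \<notin> set xs" by (auto simp: int_partitions_def)
    show "x \<in> {..n}" if "x \<in> set xs" for x using member_le_sum_list[OF that] s by simp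
    have "length xs \<le> sum_list xs" using z by (induction xs) auto
    then show "length xs \<le> n" using s by simp
  qed
qed (simp add: finite_lists_length_le)

text \<open>The character counts fixed chains, so exchanging the two sums leaves, for each chain,
  the sum of cycle types over its stabilizer.\<close>

lemma frob_ch_eq_sum_shapes:
  assumes fin: "finite (max_chains P le)"
    and part: "\<And>m. m \<in> max_chains P le \<Longrightarrow> partition_on {1..n} (Bs m)"
    and stab: "\<And>m. m \<in> max_chains P le \<Longrightarrow> stabilizer P le n act m = young_subgroup n (Bs m)"
  shows "frob_ch n (perm_character P le act) =
    (\<Sum>m\<in>max_chains P le. const_sp (real (\<Prod>B\<in>Bs m. fact (card B)) / fact n) * h_nu n (shape (Bs m)))"
proof -
  let ?M = "max_chains P le"
  have S: "finite (Sym n)" unfolding Sym_def by (simp add: finite_permutations)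
  have "frob_ch n (perm_character P le act) =
    (\<Sum>p\<in>Sym n. \<Sum>m | m \<in> ?M \<and> act p m = m. const_sp (1 / fact n) * power_sum_type n p)"
    unfolding frob_ch_def perm_character_def
    by (intro sum.cong refl)
      (simp add: const_sp_of_nat[symmetric] const_sp_mult[symmetric] mult.assoc[symmetric])
  also have "\<dots> = (\<Sum>m\<in>?M. \<Sum>p | p \<in> Sym n \<and> act p m = m. const_sp (1 / fact n) * power_sum_type n p)"
    by (rule sum.swap_restrict[OF S fin])
  also have "\<dots> = (\<Sum>m\<in>?M. const_sp (1 / fact n) * (\<Sum>p\<in>young_subgroup n (Bs m). power_sum_type n p))"
    by (intro sum.cong refl) (simp add: stab[symmetric] stabilizer_def sum_distrib_left)
  also have "\<dots> = (\<Sum>m\<in>?M. const_sp (real (\<Prod>B\<in>Bs m. fact (card B)) / fact n) * h_nu n (shape (Bs m)))"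
  proof (intro sum.cong refl)
    fix m assume "m \<in> ?M"
    then show "const_sp (1 / fact n) * (\<Sum>p\<in>young_subgroup n (Bs m). power_sum_type n p) =
      const_sp (real (\<Prod>B\<in>Bs m. fact (card B)) / fact n) * h_nu n (shape (Bs m))"
      unfolding sum_young_subgroup[OF part[OF \<open>m \<in> ?M\<close>]] h_nu_shape const_sp_of_nat[symmetric]
        mult.assoc[symmetric] const_sp_mult[symmetric] by simp
  qed
  finally show ?thesis .
qed

text \<open>The coefficient of \<open>h_nu n \<nu>\<close> is the total weight of the fibre of
  \<open>s\<close> over \<open>\<nu>\<close>.\<close>

lemma h_positive_sum:
  assumes M: "finite M" and w: "\<And>m. m \<in> M \<Longrightarrow> w m \<ge> 0" and s: "\<And>m. m \<in> M \<Longrightarrow> s m \<in> int_partitions n"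
  shows "h_positive n (\<Sum>m\<in>M. const_sp (w m) * h_nu n (s m))"
  unfolding h_positive_def
proof (intro exI conjI allI)
  let ?a = "\<lambda>\<nu>. \<Sum>m | m \<in> M \<and> s m = \<nu>. w m"
  show "?a \<nu> \<ge> 0" for \<nu> using w by (auto intro: sum_nonneg)
  have "(\<Sum>m\<in>M. const_sp (w m) * h_nu n (s m)) =
    (\<Sum>\<nu>\<in>int_partitions n. \<Sum>m | m \<in> M \<and> s m = \<nu>. const_sp (w m) * h_nu n (s m))"
    by (rule sum.group[symmetric]) (use M finite_int_partitions s in auto)
  also have "\<dots> = (\<Sum>\<nu>\<in>int_partitions n. const_sp (?a \<nu>) * h_nu n \<nu>)"
    by (intro sum.cong refl) (simp add: const_sp_sum sum_distrib_right)
  finally show "(\<Sum>m\<in>M. const_sp (w m) * h_nu n (s m)) = (\<Sum>\<nu>\<in>int_partitions n. const_sp (?a \<nu>) * h_nu n \<nu>)" .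
qed

section \<open>Uniqueness of the expansion\<close>

text \<open>The value of the monomial with exponent vector \<open>\<alpha>\<close> at the point
  \<open>(1, t, 0, 0, ...)\<close>.\<close>

definition monom_at :: "complex \<Rightarrow> (nat \<Rightarrow>\<^sub>0 nat) \<Rightarrow> complex" where
  "monom_at t \<alpha> = (if Poly_Mapping.keys \<alpha> \<subseteq> {0, 1} then t ^ Poly_Mapping.lookup \<alpha> 1 else 0)"

text \<open>The specialisation \<open>x_0 = 1\<close>, \<open>x_1 = t\<close>, \<open>x_i = 0\<close> for \<open>i > 1\<close>.\<close>

definition eval_at :: "complex \<Rightarrow> sympoly \<Rightarrow> complex" where
  "eval_at t f = (\<Sum>\<alpha>\<in>Poly_Mapping.keys f. of_real (Poly_Mapping.lookup f \<alpha>) * monom_at t \<alpha>)"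

lemma monom_at_add: "monom_at t (\<alpha> + \<beta>) = monom_at t \<alpha> * monom_at t \<beta>"
proof -
  have "Poly_Mapping.keys (\<alpha> + \<beta>) = Poly_Mapping.keys \<alpha> \<union> Poly_Mapping.keys \<beta>"
    by (auto simp: in_keys_iff lookup_add)
  then show ?thesis by (simp add: monom_at_def lookup_add power_add)
qed

lemma monom_at_zero: "monom_at t 0 = 1"
  by (simp add: monom_at_def)

text \<open>Cancellation can shrink the support of a sum; a common larger index set makes the values
  of two polynomials and of their sum comparable.\<close>

lemma eval_at_superset:
  assumes "finite K" "Poly_Mapping.keys f \<subseteq> K"
  shows "eval_at t f = (\<Sum>\<alpha>\<in>K. of_real (Poly_Mapping.lookup f \<alpha>) * monom_at t \<alpha>)"
  unfolding eval_at_def using assms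
  by (intro sum.mono_neutral_left) (auto simp: in_keys_iff)

lemma eval_at_add: "eval_at t (f + g) = eval_at t f + eval_at t g"
proof -
  let ?K = "Poly_Mapping.keys f \<union> Poly_Mapping.keys g"
  have K: "finite ?K" by simp
  show ?thesis
    using eval_at_superset[OF K, of f t] eval_at_superset[OF K, of g t]
      eval_at_superset[OF K, of "f + g" t] Poly_Mapping.keys_add[of f g]
    by (simp add: lookup_add sum.distrib algebra_simps)
qed

lemma eval_at_single: "eval_at t (Poly_Mapping.single \<alpha> c) = of_real c * monom_at t \<alpha>"
  by (simp add: eval_at_def)

lemma eval_at_zero: "eval_at t 0 = 0"
  by (simp add: eval_at_def)

lemma eval_at_one: "eval_at t 1 = 1"
  using eval_at_single[of t 0 1] by (simp add: monom_at_zero single_one)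

lemma eval_at_sum: "eval_at t (sum f A) = (\<Sum>x\<in>A. eval_at t (f x))"
  by (induction A rule: infinite_finite_induct) (auto simp: eval_at_zero eval_at_add)

lemma eval_at_const_sp: "eval_at t (const_sp c) = of_real c"
  by (simp add: const_sp_def eval_at_single monom_at_zero)

lemma sum_monomials:
  "(\<Sum>\<alpha>\<in>Poly_Mapping.keys f. Poly_Mapping.single \<alpha> (Poly_Mapping.lookup f \<alpha>)) = (f :: sympoly)"
proof (rule poly_mapping_eqI)
  fix \<beta>
  show "Poly_Mapping.lookup (\<Sum>\<alpha>\<in>Poly_Mapping.keys f. Poly_Mapping.single \<alpha> (Poly_Mapping.lookup f \<alpha>)) \<beta> =
    Poly_Mapping.lookup f \<beta>"
    by (auto simp: lookup_sum lookup_single when_def in_keys_iff sum.delta)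
qed

lemma eval_at_mult: "eval_at t (f * g) = eval_at t f * eval_at t g"
proof -
  let ?m = "\<lambda>(f::sympoly) \<alpha>. Poly_Mapping.single \<alpha> (Poly_Mapping.lookup f \<alpha>)"
  \<comment> \<open>Writing both factors as sums of monomials avoids describing the support of the
    product.\<close>
  have "f * g = (\<Sum>\<alpha>\<in>Poly_Mapping.keys f. ?m f \<alpha>) * (\<Sum>\<beta>\<in>Poly_Mapping.keys g. ?m g \<beta>)"
    by (simp only: sum_monomials)
  also have "eval_at t \<dots> = eval_at t f * eval_at t g"
    by (simp add: sum_product eval_at_sum mult_single eval_at_single monom_at_add)
      (simp add: eval_at_def sum_product algebra_simps)
  finally show ?thesis .
qed

lemma eval_at_h_nu: "eval_at t (h_nu n \<nu>) = prod_list (map (\<lambda>k. eval_at t (complete_h n k)) \<nu>)"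
  unfolding h_nu_def by (induction \<nu>) (auto simp: eval_at_one eval_at_mult)

lemma eval_at_complete_h:
  "eval_at t (complete_h n k) =
    (\<Sum>\<alpha> | Poly_Mapping.keys \<alpha> \<subseteq> {..<n} \<inter> {0, 1} \<and> (\<Sum>i<n. Poly_Mapping.lookup \<alpha> i) = k.
      t ^ Poly_Mapping.lookup \<alpha> 1)"
proof -
  let ?K = "{\<alpha>. Poly_Mapping.keys \<alpha> \<subseteq> {..<n} \<and> (\<Sum>i<n. Poly_Mapping.lookup \<alpha> i) = k}"
  have "eval_at t (complete_h n k) = (\<Sum>\<alpha>\<in>?K. monom_at t \<alpha>)"
    by (simp add: complete_h_def eval_at_sum eval_at_single)
  also have "\<dots> = (\<Sum>\<alpha> | Poly_Mapping.keys \<alpha> \<subseteq> {..<n} \<inter> {0, 1} \<and> (\<Sum>i<n. Poly_Mapping.lookup \<alpha> i) = k.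
      t ^ Poly_Mapping.lookup \<alpha> 1)"
    by (rule sum.mono_neutral_cong_right) (use finite_contents in \<open>auto simp: monom_at_def\<close>)
  finally show ?thesis .
qed

lemma eval_at_complete_h_two:
  assumes "n \<ge> 2"
  shows "eval_at t (complete_h n k) = (\<Sum>i\<le>k. t ^ i)"
  unfolding eval_at_complete_h
\<comment> \<open>The surviving monomials are \<open>x_0^(k-i) x_1^i\<close>, determined by the
  exponent of \<open>x_1\<close>; both variables exist because \<open>n \<ge> 2\<close>.\<close>
proof (rule sum.reindex_bij_witness[where i = "\<lambda>i. Poly_Mapping.single 0 (k - i) + Poly_Mapping.single 1 i"
        and j = "\<lambda>\<alpha>. Poly_Mapping.lookup \<alpha> 1"])
  have two: "(\<Sum>i<n. Poly_Mapping.lookup \<alpha> i) = Poly_Mapping.lookup \<alpha> 0 + Poly_Mapping.lookup \<alpha> 1"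
    if "Poly_Mapping.keys \<alpha> \<subseteq> {0, 1}" for \<alpha> :: "nat \<Rightarrow>\<^sub>0 nat"
  proof -
    have "(\<Sum>i<n. Poly_Mapping.lookup \<alpha> i) = (\<Sum>i\<in>{0, 1}. Poly_Mapping.lookup \<alpha> i)"
      by (rule sum.mono_neutral_right) (use assms that in \<open>auto simp: in_keys_iff subset_iff\<close>)
    then show ?thesis by simp
  qed
  fix \<alpha> :: "nat \<Rightarrow>\<^sub>0 nat"
  assume "\<alpha> \<in> {\<alpha>. Poly_Mapping.keys \<alpha> \<subseteq> {..<n} \<inter> {0, 1} \<and> (\<Sum>i<n. Poly_Mapping.lookup \<alpha> i) = k}"
  then have a: "Poly_Mapping.keys \<alpha> \<subseteq> {0, 1}" "Poly_Mapping.lookup \<alpha> 0 + Poly_Mapping.lookup \<alpha> 1 = k"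
    using two by auto
  then show "Poly_Mapping.lookup \<alpha> 1 \<in> {..k}" by auto
  show "Poly_Mapping.single 0 (k - Poly_Mapping.lookup \<alpha> 1) + Poly_Mapping.single 1 (Poly_Mapping.lookup \<alpha> 1) = \<alpha>"
  proof (rule poly_mapping_eqI)
    fix i
    show "Poly_Mapping.lookup (Poly_Mapping.single 0 (k - Poly_Mapping.lookup \<alpha> 1) +
      Poly_Mapping.single 1 (Poly_Mapping.lookup \<alpha> 1)) i = Poly_Mapping.lookup \<alpha> i"
      using a by (cases "i = 0"; cases "i = 1") (auto simp: lookup_add lookup_single when_def in_keys_iff subset_iff)
  qed
next
  fix i assume i: "i \<in> {..k}"
  let ?\<alpha> = "Poly_Mapping.single 0 (k - i) + Poly_Mapping.single (1::nat) i"
  show "Poly_Mapping.lookup ?\<alpha> 1 = i" by (simp add: lookup_add lookup_single)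
  have "Poly_Mapping.keys ?\<alpha> \<subseteq> {0, 1}" by (auto simp: in_keys_iff lookup_add lookup_single when_def split: if_splits)
  moreover have "(\<Sum>j<n. Poly_Mapping.lookup ?\<alpha> j) = k"
    using i assms by (simp add: lookup_add lookup_single when_def sum.distrib)
  ultimately show "?\<alpha> \<in> {\<alpha>. Poly_Mapping.keys \<alpha> \<subseteq> {..<n} \<inter> {0, 1} \<and> (\<Sum>i<n. Poly_Mapping.lookup \<alpha> i) = k}"
    using assms by auto
qed auto

text \<open>At \<open>t = 0\<close> only \<open>x_0^k\<close> survives. The case
  \<open>n = 1\<close> is separate, since the two-variable formula does not apply there.\<close>

lemma eval_at_zero_complete_h:
  assumes "n \<ge> 1"
  shows "eval_at 0 (complete_h n k) = 1"
proof (cases "n \<ge> 2")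
  case True
  have "(\<Sum>i\<le>k. (0::complex) ^ i) = 1" by (induction k) auto
  then show ?thesis using eval_at_complete_h_two[OF True] by simp
next
  case False
  then have n: "n = 1" using assms by simp
  have "{\<alpha>. Poly_Mapping.keys \<alpha> \<subseteq> {..<1} \<inter> {0, 1} \<and> (\<Sum>i<1. Poly_Mapping.lookup \<alpha> i) = k} =
    {Poly_Mapping.single (0::nat) k}"
  proof (intro equalityI subsetI)
    fix \<alpha> :: "nat \<Rightarrow>\<^sub>0 nat"
    assume "\<alpha> \<in> {\<alpha>. Poly_Mapping.keys \<alpha> \<subseteq> {..<1} \<inter> {0, 1} \<and> (\<Sum>i<1. Poly_Mapping.lookup \<alpha> i) = k}"
    then have "Poly_Mapping.lookup \<alpha> i = Poly_Mapping.lookup (Poly_Mapping.single (0::nat) k) i" for i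
      by (cases "i = 0") (auto simp: lookup_single when_def in_keys_iff subset_iff)
    then show "\<alpha> \<in> {Poly_Mapping.single (0::nat) k}" by (auto intro: poly_mapping_eqI)
  qed auto
  then show ?thesis unfolding n eval_at_complete_h by (simp add: lookup_single)
qed

text \<open>For a homogeneous polynomial of degree \<open>n\<close>, the value at
  \<open>t = 0\<close> is the coefficient of \<open>x_0^n\<close>. For \<open>n = 0\<close> there is
  no variable, but the only product is the empty one.\<close>

lemma eval_at_zero_h_nu:
  assumes "\<nu> \<in> int_partitions n"
  shows "eval_at 0 (h_nu n \<nu>) = 1"
proof (cases "n = 0")
  case True
  then have "\<nu> = []" using assms by (cases \<nu>) (auto simp: int_partitions_def)
  then show ?thesis by (simp add: h_nu_def eval_at_one)
next
  case False
  then have "n \<ge> 1" by simp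
  then show ?thesis unfolding eval_at_h_nu eval_at_zero_complete_h[OF \<open>n \<ge> 1\<close>]
    by (induction \<nu>) auto
qed

lemma sum_weights_eq_one:
  assumes "(\<Sum>m\<in>M. const_sp (w m) * h_nu n (s m)) = h_nu n \<nu>"
    and "\<nu> \<in> int_partitions n" "\<And>m. m \<in> M \<Longrightarrow> s m \<in> int_partitions n"
  shows "sum w M = 1"
proof -
  have "complex_of_real (sum w M) = eval_at 0 (\<Sum>m\<in>M. const_sp (w m) * h_nu n (s m))"
    by (simp add: eval_at_sum eval_at_mult eval_at_const_sp eval_at_zero_h_nu assms(3))
  also have "\<dots> = 1" using assms by (simp add: eval_at_zero_h_nu)
  finally show ?thesis by (metis of_real_eq_1_iff)
qed

text \<open>The value of \<open>h_k\<close> at \<open>(1, t)\<close>, over the complex numbers so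
  that the roots of unity are available.\<close>

definition geometric_poly :: "nat \<Rightarrow> complex poly" where
  "geometric_poly k = (\<Sum>i\<le>k. monom 1 i)"

lemma poly_geometric_poly: "poly (geometric_poly k) t = (\<Sum>i\<le>k. t ^ i)"
  by (simp add: geometric_poly_def poly_sum poly_monom)

lemma geometric_poly_nonzero: "geometric_poly k \<noteq> 0"
proof
  assume "geometric_poly k = 0"
  then have "poly (geometric_poly k) 1 = 0" by simp
  then show False unfolding poly_geometric_poly by (simp add: of_nat_Suc[symmetric] del: of_nat_Suc)
qed

lemma geometric_poly_root_iff:
  assumes "t \<noteq> 1"
  shows "poly (geometric_poly k) t = 0 \<longleftrightarrow> t ^ (k + 1) = 1"
proof -
  have "poly (geometric_poly k) t = (1 - t ^ Suc k) / (1 - t)"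
    unfolding poly_geometric_poly using sum_gp0[of t k] assms by simp
  then show ?thesis using assms by simp
qed

lemma prod_mset_poly: "poly (prod_mset A) (t::complex) = prod_mset (image_mset (\<lambda>p. poly p t) A)"
  by (induction A) auto

text \<open>A primitive root of unity of order one more than the largest part is a root of a factor on
  one side, hence on both sides, and maximality forces the same part to occur on both sides.\<close>

lemma prod_geometric_poly_max_part:
  assumes eq: "prod_mset (image_mset geometric_poly M) = prod_mset (image_mset geometric_poly N)"
    and d: "d \<in># M" "d > 0" and max: "\<And>b. b \<in># N \<Longrightarrow> b \<le> d"
  shows "d \<in># N"
proof -
  define \<zeta> where "\<zeta> = cis (2 * pi / real (d + 1))"
  have pow: "\<zeta> ^ k = 1 \<longleftrightarrow> d + 1 dvd k" for k
  proof
    have "\<zeta> ^ k = cis (2 * pi * (real k / real (d + 1)))" by (simp add: \<zeta>_def DeMoivre algebra_simps)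
    moreover assume "\<zeta> ^ k = 1"
    \<comment> \<open>The real part alone decides: a cosine equal to 1 forces a whole number of
      turns.\<close>
    ultimately have "cos (2 * pi * (real k / real (d + 1))) = 1" by (metis Re_complex_of_real cis.simps(1) of_real_1)
    then obtain j :: int where "2 * pi * (real k / real (d + 1)) = real_of_int j * 2 * pi"
      using cos_one_2pi_int by blast
    then have "(2 * pi) * (real k / real (d + 1)) = (2 * pi) * real_of_int j" by (simp only: mult_ac)
    then have "real k / real (d + 1) = real_of_int j" by (metis mult_left_cancel pi_neq_zero mult_eq_0_iff zero_neq_numeral)
    then have "real k = real_of_int j * real (d + 1)" by (simp add: divide_eq_eq)
    then have "real_of_int (int k) = real_of_int (j * int (d + 1))" by simp
    then have "int k = j * int (d + 1)" by (simp only: of_int_eq_iff)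
    then show "d + 1 dvd k" by (metis dvd_triv_right int_dvd_int_iff)
  next
    assume "d + 1 dvd k"
    then obtain j where "k = (d + 1) * j" by auto
    moreover have "\<zeta> ^ (d + 1) = 1" by (simp add: \<zeta>_def DeMoivre del: power_Suc)
    ultimately show "\<zeta> ^ k = 1" by (simp only: power_mult power_one)
  qed
  have "\<zeta> \<noteq> 1" using pow[of 1] d(2) by simp
  note root = geometric_poly_root_iff[OF this]
  have "poly (geometric_poly d) \<zeta> = 0" unfolding root pow by simp
  then have "poly (prod_mset (image_mset geometric_poly M)) \<zeta> = 0"
    using d(1) by (auto simp: prod_mset_poly prod_mset_zero_iff)
  then have "poly (prod_mset (image_mset geometric_poly N)) \<zeta> = 0" using eq by simp
  then obtain b where b: "b \<in># N" "poly (geometric_poly b) \<zeta> = 0"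
    by (auto simp: prod_mset_poly prod_mset_zero_iff)
  then have "d + 1 dvd b + 1" unfolding root pow by simp
  \<comment> \<open>A positive multiple of \<open>d + 1\<close> is at least \<open>d + 1\<close>;
    together with the maximality of \<open>d\<close> this gives \<open>b = d\<close>.\<close>
  then have "d \<le> b" using dvd_imp_le[of "d + 1" "b + 1"] by simp
  then show ?thesis using b max[OF b(1)] by simp
qed

text \<open>The largest part of both sides together occurs on each side, and its nonzero polynomial
  cancels. Zero parts must be excluded because \<open>geometric_poly 0\<close> is 1 and leaves no
  trace in the product.\<close>

lemma prod_geometric_poly_inj:
  assumes "prod_mset (image_mset geometric_poly M) = prod_mset (image_mset geometric_poly N)"
    and "0 \<notin># M" "0 \<notin># N"
  shows "M = N"
  using assms
proof (induction "size M + size N" arbitrary: M N rule: less_induct)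
  case less
  show ?case
  proof (cases "M + N = {#}")
    case False
    define d where "d = Max (set_mset (M + N))"
    have dmem: "d \<in># M + N" using False unfolding d_def by (meson Max_in finite_set_mset set_mset_eq_empty_iff)
    have max: "b \<le> d" if "b \<in># M + N" for b using that unfolding d_def by simp
    have dpos: "d > 0" using dmem less.prems by (cases d) auto
    have "d \<in># M \<and> d \<in># N"
      using dmem prod_geometric_poly_max_part[OF less.prems(1) _ dpos]
        prod_geometric_poly_max_part[OF less.prems(1)[symmetric] _ dpos] max by auto
    then obtain M' N' where MN: "M = add_mset d M'" "N = add_mset d N'"
      by (meson multi_member_split)
    have "prod_mset (image_mset geometric_poly M') = prod_mset (image_mset geometric_poly N')"
      using less.prems(1) MN geometric_poly_nonzero[of d] by simp
    then have "M' = N'" by (rule less.hyps[rotated]) (use MN less.prems in auto)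
    then show ?thesis using MN by simp
  qed simp
qed

text \<open>For \<open>n \<ge> 2\<close> agreement at every \<open>t\<close> gives equal
  polynomials, hence equal multisets of parts. For \<open>n < 2\<close> a second variable is
  missing, but there is only one partition.\<close>

lemma h_nu_inj:
  assumes eq: "h_nu n \<mu> = h_nu n \<nu>" and \<mu>: "\<mu> \<in> int_partitions n" and \<nu>: "\<nu> \<in> int_partitions n"
  shows "mset \<mu> = mset \<nu>"
proof (cases "n \<ge> 2")
  case True
  have p: "poly (prod_mset (image_mset geometric_poly (mset xs))) t = eval_at t (h_nu n xs)" for xs t
    unfolding eval_at_h_nu eval_at_complete_h_two[OF True]
    by (induction xs) (auto simp: poly_geometric_poly)
  have "poly (prod_mset (image_mset geometric_poly (mset \<mu>))) =
    poly (prod_mset (image_mset geometric_poly (mset \<nu>)))"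
    unfolding fun_eq_iff p eq by simp
  then have "prod_mset (image_mset geometric_poly (mset \<mu>)) = prod_mset (image_mset geometric_poly (mset \<nu>))"
    by (simp only: poly_eq_poly_eq_iff)
  then show ?thesis
    by (rule prod_geometric_poly_inj) (use \<mu> \<nu> in \<open>auto simp: int_partitions_def\<close>)
next
  case False
  have "xs = replicate n 1" if "xs \<in> int_partitions n" for xs
  proof (cases xs)
    case Nil
    then show ?thesis using that by (simp add: int_partitions_def)
  next
    case (Cons x ys)
    then have xy: "x + sum_list ys = n" "x \<noteq> 0" "0 \<notin> set ys" using that by (auto simp: int_partitions_def)
    then have "x = 1" "sum_list ys = 0" "n = 1" using False by arith+
    moreover from this have "ys = []" using xy(3) by (cases ys) auto
    ultimately show ?thesis using Cons by simp
  qed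
  then show ?thesis using \<mu> \<nu> by metis
qed

section \<open>Maximal chains of graded posets\<close>

locale graded_poset =
  fixes P :: "'a set" and le :: "'a \<Rightarrow> 'a \<Rightarrow> bool" and bot0 top1 :: 'a and n :: nat
  assumes ranked: "ranked_bounded_poset P le bot0 top1 n"
begin

abbreviation "M \<equiv> max_chains P le"
abbreviation "rk \<equiv> rank_of P le"

lemma fin_P: "finite P"
  using ranked by (simp add: ranked_bounded_poset_def)

lemma partial_order: "partial_order_on' P le"
  using ranked by (simp add: ranked_bounded_poset_def)

lemma le_refl: "x \<in> P \<Longrightarrow> le x x"
  using partial_order by (simp add: partial_order_on'_def)

lemma le_antisym: "x \<in> P \<Longrightarrow> y \<in> P \<Longrightarrow> le x y \<Longrightarrow> le y x \<Longrightarrow> x = y"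
  using partial_order unfolding partial_order_on'_def by (elim conjE) blast

lemma le_trans:
  assumes "x \<in> P" "y \<in> P" "z \<in> P" "le x y" "le y z"
  shows "le x z"
proof -
  have "\<forall>x\<in>P. \<forall>y\<in>P. \<forall>z\<in>P. le x y \<and> le y z \<longrightarrow> le x z"
    using partial_order unfolding partial_order_on'_def by (elim conjE)
  then show ?thesis using assms by blast
qed

lemma card_max_chain: "m \<in> M \<Longrightarrow> card m = n + 1"
  using ranked by (simp add: ranked_bounded_poset_def)

lemma max_chain_is_chain: "m \<in> M \<Longrightarrow> is_chain P le m"
  by (simp add: max_chains_def)

lemma max_chain_subset: "m \<in> M \<Longrightarrow> m \<subseteq> P"
  using max_chain_is_chain by (simp add: is_chain_def)

lemma max_chain_total: "m \<in> M \<Longrightarrow> x \<in> m \<Longrightarrow> y \<in> m \<Longrightarrow> le x y \<or> le y x"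
  using max_chain_is_chain by (simp add: is_chain_def)

lemma finite_max_chain: "m \<in> M \<Longrightarrow> finite m"
  by (rule finite_subset[OF max_chain_subset fin_P])

lemma finite_max_chains: "finite M"
proof (rule finite_subset)
  show "M \<subseteq> Pow P" using max_chain_subset by blast
qed (use fin_P in simp)

lemma extend_chain:
  assumes "is_chain P le K"
  shows "\<exists>m\<in>M. K \<subseteq> m"
proof -
  let ?A = "{D. is_chain P le D \<and> K \<subseteq> D}"
  have "finite ?A" by (rule finite_subset[of _ "Pow P"]) (use fin_P in \<open>auto simp: is_chain_def\<close>)
  moreover have K: "K \<in> ?A" using assms by simp
  ultimately have "\<exists>m\<in>?A. K \<le> m \<and> (\<forall>D\<in>?A. m \<le> D \<longrightarrow> m = D)"
    by (rule finite_has_maximal2)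
  then obtain m where m: "is_chain P le m" "K \<subseteq> m"
    and max: "\<forall>D\<in>?A. m \<subseteq> D \<longrightarrow> m = D" by blast
  have "m \<in> M" unfolding max_chains_def
  proof (intro CollectI conjI allI impI)
    fix D assume D: "is_chain P le D \<and> m \<subseteq> D"
    then have "D \<in> ?A" using m(2) by blast
    then show "D = m" using D max by blast
  qed (rule m)
  then show ?thesis using m by blast
qed

lemma card_chain_le:
  assumes "is_chain P le K"
  shows "card K \<le> n + 1"
proof -
  obtain m where m: "m \<in> M" "K \<subseteq> m" using extend_chain[OF assms] by blast
  then show ?thesis using card_mono[OF finite_max_chain[OF m(1)] m(2)] card_max_chain[OF m(1)] by simp
qed

lemma card_chain_max:
  assumes "is_chain P le K" "card K = n + 1"
  shows "K \<in> M"
proof -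
  obtain m where m: "m \<in> M" "K \<subseteq> m" using extend_chain[OF assms(1)] by blast
  then have "K = m" using card_subset_eq[OF finite_max_chain[OF m(1)] m(2)] card_max_chain[OF m(1)] assms(2) by simp
  then show ?thesis using m by simp
qed

text \<open>\<open>rank_of\<close> ranges over all chains below \<open>x\<close>, yet any maximal
  chain through \<open>x\<close> attains the maximum: a longer chain \<open>K\<close> below
  \<open>x\<close>, continued by the part of \<open>m\<close> above \<open>x\<close>, would exceed
  \<open>n + 1\<close> elements.\<close>

lemma card_below_in_max_chain:
  assumes m: "m \<in> M" and x: "x \<in> m"
  shows "card {y\<in>m. le y x} = rk x + 1"
proof -
  let ?D = "{y\<in>m. le y x}"
  let ?S = "{K. is_chain P le K \<and> (\<forall>y\<in>K. le y x)}"
  note mP = max_chain_subset[OF m] and fm = finite_max_chain[OF m]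
  have xP: "x \<in> P" using x mP by blast
  have DS: "?D \<in> ?S" using max_chain_is_chain[OF m] by (auto simp: is_chain_def)
  have le: "card K \<le> card ?D" if K: "K \<in> ?S" for K
  proof -
    have KP: "K \<subseteq> P" and Kx: "\<And>y. y \<in> K \<Longrightarrow> le y x" using K by (auto simp: is_chain_def)
    have fK: "finite K" using KP fin_P finite_subset by metis
    have up: "le k c" if "k \<in> K" "c \<in> m - ?D" for k c
    proof -
      have "le x c" using that max_chain_total[OF m x, of c] by auto
      then show ?thesis using that KP mP xP Kx by (meson DiffE le_trans subsetD)
    qed
    have "is_chain P le (K \<union> (m - ?D))"
      using K up max_chain_is_chain[OF m] by (auto simp: is_chain_def)
    then have "card (K \<union> (m - ?D)) \<le> n + 1" by (rule card_chain_le)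
    moreover have "K \<inter> (m - ?D) = {}" using Kx by auto
    then have "card (K \<union> (m - ?D)) = card K + card (m - ?D)"
      using card_Un_disjoint[OF fK] fm by blast
    moreover have "card (m - ?D) = n + 1 - card ?D"
      using card_Diff_subset[of ?D m] fm card_max_chain[OF m] by auto
    moreover have "card ?D \<le> n + 1" using card_mono[OF fm, of ?D] card_max_chain[OF m] by auto
    ultimately show ?thesis by linarith
  qed
  have "finite ?S" by (rule finite_subset[of _ "Pow P"]) (use fin_P in \<open>auto simp: is_chain_def\<close>)
  then have "Max (card ` ?S) = card ?D"
    using DS le by (intro Max_eqI) auto
  moreover have "x \<in> ?D" using x le_refl[OF xP] by simp
  then have "card ?D > 0" using fm by (auto simp: card_gt_0_iff)
  ultimately show ?thesis unfolding rank_of_def by simp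
qed

lemma le_iff_rank_le:
  assumes m: "m \<in> M" and x: "x \<in> m" and y: "y \<in> m"
  shows "le x y \<longleftrightarrow> rk x \<le> rk y"
proof -
  have mono: "rk x < rk y" if "x \<in> m" "y \<in> m" "le x y" "x \<noteq> y" for x y
  proof -
    have P: "x \<in> P" "y \<in> P" using that max_chain_subset[OF m] by auto
    have "{z\<in>m. le z x} \<subset> {z\<in>m. le z y}"
    proof
      show "{z\<in>m. le z x} \<subseteq> {z\<in>m. le z y}" using that P max_chain_subset[OF m] by (auto intro: le_trans)
      have "y \<notin> {z\<in>m. le z x}" using that P le_antisym by blast
      then show "{z\<in>m. le z x} \<noteq> {z\<in>m. le z y}" using that P le_refl by blast
    qed
    then have "card {z\<in>m. le z x} < card {z\<in>m. le z y}"
      using finite_max_chain[OF m] by (intro psubset_card_mono) auto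
    then show ?thesis using card_below_in_max_chain[OF m] that by simp
  qed
  show ?thesis
  proof (cases "x = y")
    case True
    then show ?thesis using le_refl max_chain_subset[OF m] x by auto
  next
    case False
    then show ?thesis using mono[OF x y] mono[OF y x] max_chain_total[OF m x y] by fastforce
  qed
qed

lemma bij_betw_rank:
  assumes m: "m \<in> M"
  shows "bij_betw rk m {..n}"
proof -
  have inj: "inj_on rk m"
  proof (rule inj_onI)
    fix x y assume "x \<in> m" "y \<in> m" "rk x = rk y"
    then show "x = y" using le_iff_rank_le[OF m] max_chain_subset[OF m] le_antisym by (metis order_refl subsetD)
  qed
  have "rk ` m \<subseteq> {..n}"
  proof
    fix i assume "i \<in> rk ` m"
    then obtain x where x: "x \<in> m" "i = rk x" by blast
    have "card {y\<in>m. le y x} \<le> card m" using finite_max_chain[OF m] by (intro card_mono) auto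
    then show "i \<in> {..n}" using x card_below_in_max_chain[OF m] card_max_chain[OF m] by simp
  qed
  moreover have "card (rk ` m) = card {..n}" using card_image[OF inj] card_max_chain[OF m] by simp
  ultimately show ?thesis using inj by (simp add: bij_betw_def card_subset_eq)
qed

text \<open>The element of rank \<open>i\<close> in the chain \<open>m\<close>; meaningful for
  \<open>i \<le> n\<close>, where \<open>rk\<close> is a bijection from \<open>m\<close> onto
  \<open>{..n}\<close>.\<close>

definition elt :: "'a set \<Rightarrow> nat \<Rightarrow> 'a" where
  "elt m = inv_into m rk"

lemma rank_image: "m \<in> M \<Longrightarrow> rk ` m = {..n}"
  using bij_betw_rank by (simp add: bij_betw_def)

lemma elt_in: "m \<in> M \<Longrightarrow> i \<le> n \<Longrightarrow> elt m i \<in> m"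
  unfolding elt_def by (rule inv_into_into) (simp add: rank_image)

lemma rank_elt: "m \<in> M \<Longrightarrow> i \<le> n \<Longrightarrow> rk (elt m i) = i"
  unfolding elt_def by (rule f_inv_into_f) (simp add: rank_image)

lemma elt_rank: "m \<in> M \<Longrightarrow> x \<in> m \<Longrightarrow> elt m (rk x) = x"
  unfolding elt_def by (rule inv_into_f_f[OF bij_betw_imp_inj_on[OF bij_betw_rank]])

lemma rank_le: "m \<in> M \<Longrightarrow> x \<in> m \<Longrightarrow> rk x \<le> n"
  using rank_image by blast

lemma elt_image:
  assumes "m \<in> M"
  shows "elt m ` {..n} = m"
proof (intro equalityI subsetI)
  fix x assume "x \<in> m"
  then show "x \<in> elt m ` {..n}" using elt_rank[OF assms, of x] rank_le[OF assms, of x] by (auto intro: rev_image_eqI)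
qed (use elt_in[OF assms] in auto)

lemma max_chain_eqI:
  assumes "m \<in> M" "m' \<in> M" "\<And>i. i \<le> n \<Longrightarrow> elt m i = elt m' i"
  shows "m = m'"
proof -
  have "m = elt m ` {..n}" by (rule elt_image[OF assms(1), symmetric])
  also have "\<dots> = elt m' ` {..n}" by (rule image_cong[OF refl]) (use assms(3) in simp)
  also have "\<dots> = m'" by (rule elt_image[OF assms(2)])
  finally show ?thesis .
qed

lemma elt_le_iff:
  assumes "m \<in> M" "i \<le> n" "j \<le> n"
  shows "le (elt m i) (elt m j) \<longleftrightarrow> i \<le> j"
  using le_iff_rank_le[OF assms(1) elt_in[OF assms(1,2)] elt_in[OF assms(1,3)]]
    rank_elt[OF assms(1,2)] rank_elt[OF assms(1,3)] by simp

text \<open>Elements on different sides of the junction are comparable through the common element of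
  rank \<open>i\<close>; distinct ranks give \<open>n + 1\<close> elements, which makes the glued
  chain maximal.\<close>

lemma splice_max_chains:
  assumes m: "m \<in> M" and m': "m' \<in> M" and i: "i \<le> n" and eq: "elt m i = elt m' i"
  obtains d where "d \<in> M" "\<And>j. j \<le> i \<Longrightarrow> elt d j = elt m j"
    "\<And>j. i \<le> j \<Longrightarrow> j \<le> n \<Longrightarrow> elt d j = elt m' j"
proof -
  define g where "g j = (if j \<le> i then elt m j else elt m' j)" for j
  have rg: "rk (g j) = j" if "j \<le> n" for j using that i rank_elt m m' by (simp add: g_def)
  have gP: "g j \<in> P" if "j \<le> n" for j
    using that elt_in m m' max_chain_subset by (auto simp: g_def)
  have mono: "le (g j) (g k)" if "j \<le> k" "k \<le> n" for j k
  proof -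
    consider "k \<le> i" | "j \<le> i" "i < k" | "i < j" using that by linarith
    then show ?thesis
    proof cases
      case 2
      have "le (elt m j) (elt m i)" "le (elt m i) (elt m' k)"
        using 2 that i elt_le_iff[OF m, of j i] elt_le_iff[OF m', of i k] eq by auto
      then have "le (elt m j) (elt m' k)"
        using gP[of j] gP[of k] gP[of i] 2 that i by (auto simp: g_def eq intro: le_trans)
      then show ?thesis using 2 by (simp add: g_def)
    qed (use that i elt_le_iff[OF m] elt_le_iff[OF m'] in \<open>auto simp: g_def\<close>)
  qed
  let ?d = "g ` {..n}"
  have "inj_on g {..n}" by (rule inj_on_inverseI[of _ rk]) (use rg in auto)
  then have "card ?d = n + 1" by (simp add: card_image)
  moreover have "is_chain P le ?d"
    unfolding is_chain_def using gP mono by (auto simp: image_iff) (metis linear)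
  ultimately have d: "?d \<in> M" using card_chain_max by blast
  have "elt ?d j = g j" if "j \<le> n" for j
    using elt_rank[OF d, of "g j"] rg[OF that] that by simp
  then show ?thesis using that[OF d] i eq by (auto simp: g_def)
qed

lemma max_chain_through:
  assumes "x \<in> P" "y \<in> P" "le x y"
  obtains m where "m \<in> M" "x \<in> m" "y \<in> m"
proof -
  have "is_chain P le {x, y}" using assms le_refl by (auto simp: is_chain_def)
  then show ?thesis using extend_chain that by blast
qed

end

text \<open>Composing with \<open>transpose x (p x)\<close> fixes \<open>x\<close> and shrinks the
  support. The point formerly sent to \<open>x\<close> now goes to \<open>p x\<close>, which is
  where transitivity of \<open>r\<close> enters. It is applied with \<open>r\<close> as "same side
  of \<open>i\<close>" and as the block relation.\<close>

lemma permutes_in_closure: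
  fixes p :: "'b \<Rightarrow> 'b"
  assumes A: "finite A" and p: "p permutes A" and id: "id \<in> G"
    and comp: "\<And>f g. f \<in> G \<Longrightarrow> g \<in> G \<Longrightarrow> f \<circ> g \<in> G"
    and tr: "\<And>a b. a \<in> A \<Longrightarrow> b \<in> A \<Longrightarrow> a \<noteq> b \<Longrightarrow> r a b \<Longrightarrow> transpose a b \<in> G"
    and trans: "\<And>a b c. r a b \<Longrightarrow> r b c \<Longrightarrow> r a c"
    and r: "\<And>x. x \<in> A \<Longrightarrow> p x \<noteq> x \<Longrightarrow> r x (p x)"
  shows "p \<in> G"
  using p r
proof (induction "card {x. p x \<noteq> x}" arbitrary: p rule: less_induct)
  case less
  show ?case
  proof (cases "p = id")
    case False
    then obtain x where x: "p x \<noteq> x" by fastforce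
    have xA: "x \<in> A" using x less.prems(1) by (auto simp: permutes_def)
    have pxA: "p x \<in> A" using xA less.prems(1) by (simp add: permutes_in_image)
    have inj: "inj p" using less.prems(1) by (rule permutes_inj)
    define q where "q = transpose x (p x) \<circ> p"
    have q: "q permutes A" unfolding q_def
      by (rule permutes_compose[OF less.prems(1) permutes_swap_id[OF xA pxA]])
    have "{y. q y \<noteq> y} \<subset> {y. p y \<noteq> y}"
    proof
      show "{y. q y \<noteq> y} \<subseteq> {y. p y \<noteq> y}"
        using x injD[OF inj] by (auto simp: q_def transpose_def split: if_splits)
      have "q x = x" by (simp add: q_def)
      then show "{y. q y \<noteq> y} \<noteq> {y. p y \<noteq> y}" using x by blast
    qed
    moreover have "finite {y. p y \<noteq> y}"
      by (rule finite_subset[OF _ A]) (use less.prems(1) in \<open>auto simp: permutes_def\<close>)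
    ultimately have "card {y. q y \<noteq> y} < card {y. p y \<noteq> y}" by (simp add: psubset_card_mono)
    moreover have "r y (q y)" if y: "y \<in> A" "q y \<noteq> y" for y
    proof (cases "p y = x")
      case True
      then have "p y \<noteq> y" using x by metis
      then have "r y x" using less.prems(2)[OF y(1)] True by simp
      then show ?thesis using True less.prems(2)[OF xA x] trans by (auto simp: q_def)
    next
      case False
      moreover have "p y \<noteq> p x" using y injD[OF inj, of y x] by (auto simp: q_def)
      ultimately have "q y = p y" by (simp add: q_def)
      then show ?thesis using less.prems(2)[OF y(1)] y(2) by simp
    qed
    ultimately have "q \<in> G" using less.hyps q by blast
    moreover have "transpose x (p x) \<in> G" using tr[OF xA pxA] x less.prems(2)[OF xA x] by simp
    ultimately have "transpose x (p x) \<circ> q \<in> G" using comp by blast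
    moreover have "transpose x (p x) \<circ> q = p" by (simp add: q_def comp_assoc[symmetric])
    ultimately show ?thesis by simp
  qed (use id in simp)
qed

text \<open>One \<open>w\<close> for both sets puts the elements of \<open>P\<close> attached to
  \<open>S\<close> and \<open>S'\<close> on a single maximal chain, where they can be
  compared.\<close>

lemma sorting_permutation:
  assumes S: "S \<subseteq> S'" and S': "S' \<subseteq> {1..n}"
  obtains w where "w \<in> Sym n" "w ` S = {1..card S}" "w ` S' = {1..card S'}"
proof -
  have fin: "finite S" "finite S'" using S S' finite_subset by (metis finite_atLeastAtMost)+
  have le: "card S \<le> card S'" "card S' \<le> n"
    using card_mono[OF fin(2) S] card_mono[OF _ S'] by auto
  obtain f where f: "bij_betw f S {1..card S}"
    using finite_same_card_bij[OF fin(1), of "{1..card S}"] by auto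
  obtain g where g: "bij_betw g (S' - S) {card S + 1..card S'}"
    using finite_same_card_bij[of "S' - S" "{card S + 1..card S'}"] fin S le by (auto simp: card_Diff_subset)
  obtain h where h: "bij_betw h ({1..n} - S') {card S' + 1..n}"
    using finite_same_card_bij[of "{1..n} - S'" "{card S' + 1..n}"] fin S' le by (auto simp: card_Diff_subset)
  define w where "w x = (if x \<in> S then f x else if x \<in> S' then g x else if x \<in> {1..n} then h x else x)" for x
  have wf: "bij_betw w S {1..card S}"
    by (rule iffD1[OF bij_betw_cong f]) (auto simp: w_def)
  have wg: "bij_betw w (S' - S) {card S + 1..card S'}"
    by (rule iffD1[OF bij_betw_cong g]) (auto simp: w_def)
  have wh: "bij_betw w ({1..n} - S') {card S' + 1..n}"
    by (rule iffD1[OF bij_betw_cong h]) (use S in \<open>auto simp: w_def\<close>)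
  have e: "{1..card S} \<union> {card S + 1..card S'} = {1..card S'}" "{1..card S'} \<union> {card S' + 1..n} = {1..n}"
    "S \<union> (S' - S) = S'" "S' \<union> ({1..n} - S') = {1..n}"
    using le S S' by auto
  have w': "bij_betw w S' {1..card S'}" using bij_betw_combine[OF wf wg] unfolding e by auto
  have "bij_betw w {1..n} {1..n}" using bij_betw_combine[OF w' wh] unfolding e by auto
  then have "w permutes {1..n}" by (rule bij_imp_permutes) (use S S' in \<open>auto simp: w_def\<close>)
  then have "w \<in> Sym n" by (simp add: Sym_def)
  then show ?thesis using that wf w' by (simp add: bij_betw_def)
qed

section \<open>Local actions and stabilizers\<close>

lemma Sym_id: "id \<in> Sym n"
  and Sym_comp: "p \<in> Sym n \<Longrightarrow> q \<in> Sym n \<Longrightarrow> p \<circ> q \<in> Sym n"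
  and Sym_inv: "p \<in> Sym n \<Longrightarrow> inv p \<in> Sym n"
  and Sym_permutes: "p \<in> Sym n \<Longrightarrow> p permutes {1..n}"
  by (auto simp: Sym_def permutes_id intro: permutes_compose permutes_inv)

lemma Sym_transpose: "a \<in> {1..n} \<Longrightarrow> b \<in> {1..n} \<Longrightarrow> transpose a b \<in> Sym n"
  by (simp add: Sym_def permutes_swap_id)

lemma finite_Sym: "finite (Sym n)"
  by (simp add: Sym_def finite_permutations)

lemma card_Sym: "card (Sym n) = fact n"
  using card_permutations[of "{1..n}" n] by (simp add: Sym_def)

lemma Sym_inverses:
  assumes "p \<in> Sym n"
  shows "p (inv p x) = x" "inv p (p x) = x" "p \<circ> inv p = id" "inv p \<circ> p = id"
  using permutes_inverses[OF Sym_permutes[OF assms]] permutes_inv_o[OF Sym_permutes[OF assms]] by auto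

lemma Sym_inj: "p \<in> Sym n \<Longrightarrow> inj p"
  using permutes_inj Sym_permutes by blast

lemma Sym_in_iff: "p \<in> Sym n \<Longrightarrow> p x \<in> {1..n} \<longleftrightarrow> x \<in> {1..n}"
  using permutes_in_image Sym_permutes by metis

lemma Sym_image_subset: "p \<in> Sym n \<Longrightarrow> S \<subseteq> {1..n} \<Longrightarrow> p ` S \<subseteq> {1..n}"
  using Sym_in_iff by (metis image_subset_iff subsetD)

lemma Sym_card_image: "p \<in> Sym n \<Longrightarrow> card (p ` S) = card S"
  using Sym_inj by (metis card_image inj_on_subset subset_UNIV)

lemma Sym_inv_image: "p \<in> Sym n \<Longrightarrow> p ` (inv p ` S) = S" "p \<in> Sym n \<Longrightarrow> inv p ` (p ` S) = S"
  by (simp_all add: image_comp Sym_inverses(3,4)[of p n])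

lemma Sym_comp_transpose: "p \<in> Sym n \<Longrightarrow> p \<circ> transpose a b = transpose (p a) (p b) \<circ> p"
  using injD[OF Sym_inj] by (auto simp: fun_eq_iff transpose_def)

locale local_sym_action = graded_poset P le bot0 top1 n
  for P :: "'a set" and le bot0 top1 n +
  fixes act :: "(nat \<Rightarrow> nat) \<Rightarrow> 'a set \<Rightarrow> 'a set"
  assumes local: "local_action P le n act"
begin

abbreviation "St \<equiv> stabilizer P le n act"

lemma act_in: "p \<in> Sym n \<Longrightarrow> m \<in> M \<Longrightarrow> act p m \<in> M"
  using local by (simp add: local_action_def)

lemma act_id: "m \<in> M \<Longrightarrow> act id m = m"
  using local by (simp add: local_action_def)

lemma act_comp: "p \<in> Sym n \<Longrightarrow> q \<in> Sym n \<Longrightarrow> m \<in> M \<Longrightarrow> act (p \<circ> q) m = act p (act q m)"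
  using local by (simp add: local_action_def)

lemma act_inv_eq_iff:
  assumes "p \<in> Sym n" "m \<in> M" "m' \<in> M"
  shows "act p m = m' \<longleftrightarrow> m = act (inv p) m'"
proof
  assume "act p m = m'"
  then show "m = act (inv p) m'"
    using act_comp[OF Sym_inv[OF assms(1)] assms(1,2)] Sym_inverses(4)[OF assms(1)] act_id[OF assms(2)] by simp
next
  assume "m = act (inv p) m'"
  then show "act p m = m'"
    using act_comp[OF assms(1) Sym_inv[OF assms(1)] assms(3)] Sym_inverses(3)[OF assms(1)] act_id[OF assms(3)] by simp
qed

lemma elt_act_adjacent:
  assumes i: "1 \<le> i" "i \<le> n - 1" and m: "m \<in> M" and j: "j \<le> n" "j \<noteq> i"
  shows "elt (act (transpose i (i + 1)) m) j = elt m j"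
proof -
  let ?m = "act (transpose i (i + 1)) m"
  have "transpose i (i + 1) \<in> Sym n" using i by (intro Sym_transpose) auto
  then have m': "?m \<in> M" using act_in m by blast
  have "\<forall>i. 1 \<le> i \<and> i \<le> n - 1 \<longrightarrow>
      (\<forall>m\<in>M. {x\<in>act (transpose i (i + 1)) m. rk x \<noteq> i} = {x\<in>m. rk x \<noteq> i})"
    using local unfolding local_action_def by (elim conjE)
  then have eq: "{x\<in>?m. rk x \<noteq> i} = {x\<in>m. rk x \<noteq> i}"
    by (rule allE[of _ i]) (use i m in blast)
  have "elt m j \<in> {x\<in>m. rk x \<noteq> i}" using elt_in[OF m j(1)] rank_elt[OF m j(1)] j(2) by simp
  then have "elt m j \<in> ?m" using eq by blast
  then show ?thesis using elt_rank[OF m', of "elt m j"] rank_elt[OF m j(1)] by simp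
qed

text \<open>A permutation preserving \<open>{1..i}\<close> is a product of transpositions that do
  not cross the cut between \<open>i\<close> and \<open>i + 1\<close>, and these are products of
  adjacent ones other than \<open>(i, i+1)\<close>, none of which touches rank
  \<open>i\<close>.\<close>

lemma elt_act_preserving:
  assumes u: "u \<in> Sym n" and i: "i \<le> n" and pres: "u ` {1..i} = {1..i}" and m: "m \<in> M"
  shows "elt (act u m) i = elt m i"
proof -
  \<comment> \<open>The quantifier over all chains makes \<open>G\<close> closed under composition,
    since the second factor acts on a chain already moved by the first.\<close>
  define G where "G = {u \<in> Sym n. \<forall>m\<in>M. elt (act u m) i = elt m i}"
  have comp: "f \<circ> g \<in> G" if "f \<in> G" "g \<in> G" for f g
    using that Sym_comp act_comp act_in by (simp add: G_def)
  have adj: "transpose j (j + 1) \<in> G" if "1 \<le> j" "j + 1 \<le> n" "j \<noteq> i" for j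
    unfolding G_def using that i elt_act_adjacent[of j _ i] Sym_transpose[of j n "j + 1"] by auto
  have up: "transpose a b \<in> G" if "a < b" "1 \<le> a" "b \<le> n" "a \<le> i \<longleftrightarrow> b \<le> i" for a b
    using that
  proof (induction b)
    case (Suc b)
    show ?case
    proof (cases "a = b")
      case True
      then show ?thesis using adj[of b] Suc.prems by auto
    next
      case False
      then have ab: "a < b" using Suc.prems by simp
      have "transpose a b \<in> G" using Suc ab by auto
      moreover have "transpose b (Suc b) \<in> G" using adj[of b] Suc.prems ab by auto
      \<comment> \<open>Conjugation by \<open>(b, b+1)\<close> lengthens \<open>(a, b)\<close> to
        \<open>(a, b+1)\<close>; both ends stay on the same side of the cut.\<close>
      ultimately have "transpose b (Suc b) \<circ> transpose a b \<circ> transpose b (Suc b) \<in> G" using comp by blast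
      moreover have "transpose b (Suc b) \<circ> transpose a b \<circ> transpose b (Suc b) = transpose a (Suc b)"
        using transpose_comp_triple[of "Suc b" a b] ab by (simp add: transpose_commute)
      ultimately show ?thesis by simp
    qed
  qed simp
  have "u \<in> G"
  proof (rule permutes_in_closure[where r = "\<lambda>a b. a \<le> i \<longleftrightarrow> b \<le> i"])
    show "u permutes {1..n}" using Sym_permutes[OF u] .
    show "id \<in> G" using Sym_id act_id by (simp add: G_def)
    show "transpose a b \<in> G" if "a \<in> {1..n}" "b \<in> {1..n}" "a \<noteq> b" "a \<le> i \<longleftrightarrow> b \<le> i" for a b
      using up[of a b] up[of b a] that by (cases "a < b") (auto simp: transpose_commute)
    show "x \<le> i \<longleftrightarrow> u x \<le> i" if "x \<in> {1..n}" for x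
    proof -
      have "u x \<in> u ` {1..i} \<longleftrightarrow> x \<in> {1..i}" using inj_image_mem_iff[OF Sym_inj[OF u]] .
      moreover have "u x \<in> {1..n}" using Sym_in_iff[OF u] that by blast
      ultimately show ?thesis using that unfolding pres by auto
    qed
  qed (use comp in auto)
  then show ?thesis using m by (simp add: G_def)
qed

text \<open>By \<open>elt_act_preserving\<close>, the element of rank \<open>i\<close> of \<open>w c\<close> depends only on
  the \<open>w\<close>-preimage of \<open>{1..i}\<close>. This gives an order-preserving map from subsets of \<open>{1..n}\<close> to \<open>P\<close>.\<close>

definition subset_elt :: "'a set \<Rightarrow> nat set \<Rightarrow> 'a" where
  "subset_elt c S = elt (act (SOME w. w \<in> Sym n \<and> w ` S = {1..card S}) c) (card S)"

text \<open>Two permutations sorting \<open>S\<close> differ by a left factor preserving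
  \<open>{1..card S}\<close>, so the choice made by \<open>SOME\<close> is immaterial.\<close>

lemma subset_elt_eq:
  assumes c: "c \<in> M" and w: "w \<in> Sym n" and S: "S \<subseteq> {1..n}" and wS: "w ` S = {1..card S}"
  shows "subset_elt c S = elt (act w c) (card S)"
proof -
  define v where "v = (SOME w. w \<in> Sym n \<and> w ` S = {1..card S})"
  have v: "v \<in> Sym n \<and> v ` S = {1..card S}"
    unfolding v_def by (rule someI[of _ w]) (use w wS in simp)
  have le: "card S \<le> n" using card_mono[OF _ S] by simp
  define u where "u = w \<circ> inv v"
  have u: "u \<in> Sym n" unfolding u_def using w v Sym_comp Sym_inv by blast
  have "inv v ` {1..card S} = S" using Sym_inv_image(2)[of v n S] v by simp
  then have "u ` {1..card S} = {1..card S}" using wS unfolding u_def image_comp[symmetric] by simp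
  then have "elt (act u (act v c)) (card S) = elt (act v c) (card S)"
    using elt_act_preserving[OF u le] act_in v c by blast
  moreover have "act u (act v c) = act (u \<circ> v) c" using act_comp[OF u _ c] v by simp
  moreover have "u \<circ> v = w" unfolding u_def using Sym_inverses(4)[of v n] v by (simp add: comp_assoc)
  ultimately show ?thesis unfolding subset_elt_def v_def by simp
qed

text \<open>Every chain in the orbit is thus the image under \<open>subset_elt c\<close> of a full
  flag of subsets, the preimages of the initial segments.\<close>

lemma elt_act:
  assumes c: "c \<in> M" and w: "w \<in> Sym n" and i: "i \<le> n"
  shows "elt (act w c) i = subset_elt c (inv w ` {1..i})"
proof -
  have card: "card (inv w ` {1..i}) = i" using Sym_card_image[OF Sym_inv[OF w]] by simp
  have "inv w ` {1..i} \<subseteq> {1..n}" using Sym_image_subset[OF Sym_inv[OF w]] i by simp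
  then show ?thesis using subset_elt_eq[OF c w, of "inv w ` {1..i}"] card Sym_inv_image(1)[OF w] by simp
qed

lemma subset_elt_le:
  assumes c: "c \<in> M" and S: "S \<subseteq> S'" "S' \<subseteq> {1..n}"
  shows "le (subset_elt c S) (subset_elt c S')"
proof -
  obtain w where w: "w \<in> Sym n" "w ` S = {1..card S}" "w ` S' = {1..card S'}"
    using sorting_permutation[OF S] by metis
  have "finite S'" using S(2) finite_subset by blast
  then have "card S \<le> card S'" "card S' \<le> n" using card_mono S(1) card_mono[OF _ S(2)] by auto
  then show ?thesis
    using subset_elt_eq[OF c w(1) _ w(2)] subset_elt_eq[OF c w(1) _ w(3)] S elt_le_iff[OF act_in[OF w(1) c]]
    by auto
qed

lemma subset_elt_in:
  assumes c: "c \<in> M" and S: "S \<subseteq> {1..n}"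
  obtains w where "w \<in> Sym n" "inv w ` {1..card S} = S" "card S \<le> n"
    "subset_elt c S = elt (act w c) (card S)" "subset_elt c S \<in> P" "rk (subset_elt c S) = card S"
proof -
  obtain w where w: "w \<in> Sym n" "w ` S = {1..card S}"
    using sorting_permutation[OF order_refl S] by metis
  have le: "card S \<le> n" using card_mono[OF _ S] by simp
  have eq: "subset_elt c S = elt (act w c) (card S)" using subset_elt_eq[OF c w(1) S w(2)] .
  have m: "act w c \<in> M" using act_in w c by blast
  have "subset_elt c S \<in> P" "rk (subset_elt c S) = card S"
    unfolding eq using elt_in[OF m le] rank_elt[OF m le] max_chain_subset[OF m] by auto
  moreover have "inv w ` {1..card S} = S" using Sym_inv_image(2)[OF w(1), of S] w(2) by simp
  ultimately show ?thesis using that w(1) le eq by blast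
qed

lemma in_stabilizer_iff: "h \<in> St c \<longleftrightarrow> h \<in> Sym n \<and> act h c = c"
  by (simp add: stabilizer_def)

lemma stabilizer_id: "c \<in> M \<Longrightarrow> id \<in> St c"
  using Sym_id act_id by (simp add: in_stabilizer_iff)

lemma stabilizer_comp: "c \<in> M \<Longrightarrow> f \<in> St c \<Longrightarrow> g \<in> St c \<Longrightarrow> f \<circ> g \<in> St c"
  using Sym_comp act_comp by (simp add: in_stabilizer_iff)

lemma stabilizer_inv: "c \<in> M \<Longrightarrow> h \<in> St c \<Longrightarrow> inv h \<in> St c"
  using Sym_inv act_inv_eq_iff[of h c c] by (auto simp: in_stabilizer_iff)

lemma subset_elt_stabilizer:
  assumes c: "c \<in> M" and h: "h \<in> St c" and S: "S \<subseteq> {1..n}"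
  shows "subset_elt c (h ` S) = subset_elt c S"
proof -
  have hn: "h \<in> Sym n" using h by (simp add: in_stabilizer_iff)
  have hi: "inv h \<in> Sym n" "act (inv h) c = c" using stabilizer_inv[OF c h] by (auto simp: in_stabilizer_iff)
  obtain w where w: "w \<in> Sym n" "w ` S = {1..card S}"
    using sorting_permutation[OF order_refl S] by metis
  have card: "card (h ` S) = card S" using Sym_card_image[OF hn] .
  have "(w \<circ> inv h) ` (h ` S) = {1..card (h ` S)}"
    unfolding card image_comp[symmetric] Sym_inv_image(2)[OF hn] w(2) ..
  then have "subset_elt c (h ` S) = elt (act (w \<circ> inv h) c) (card (h ` S))"
    using subset_elt_eq[OF c Sym_comp[OF w(1) hi(1)] Sym_image_subset[OF hn S]] by blast
  also have "\<dots> = subset_elt c S"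
    using act_comp[OF w(1) hi(1) c] hi(2) card subset_elt_eq[OF c w(1) S w(2)] by simp
  finally show ?thesis .
qed

text \<open>The two chains below agree in all ranks except possibly \<open>card X + 1\<close>, hence they are equal.\<close>

lemma transpose_in_stabilizer_sorted:
  assumes c: "c \<in> M" and X: "X \<subseteq> {1..n}" and ab: "a \<in> {1..n} - X" "b \<in> {1..n} - X" "a \<noteq> b"
    and eq: "subset_elt c (insert a X) = subset_elt c (insert b X)"
    and w: "w \<in> Sym n" "w ` X = {1..card X}" "w a = card X + 1" "w b = card X + 2"
  shows "transpose a b \<in> St c"
proof -
  let ?k = "card X + 1"
  let ?t = "transpose ?k (?k + 1)"
  have finX: "finite X" using X finite_subset by blast
  have tab: "transpose a b \<in> Sym n" using ab Sym_transpose by blast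
  have kn: "?k + 1 \<le> n" using Sym_in_iff[OF w(1), of b] ab w(4) by simp
  have t: "?t \<in> Sym n" using kn by (intro Sym_transpose) auto
  have m: "act w c \<in> M" using act_in w(1) c by blast
  have card: "card (insert a X) = ?k" "card (insert b X) = ?k" using finX ab by auto
  have iv: "insert ?k {1..card X} = {1..?k}" by auto
  \<comment> \<open>As \<open>w\<close> places \<open>a\<close> right after \<open>X\<close> and
    \<open>b\<close> next, it sorts \<open>insert a X\<close>, while \<open>?t \<circ> w\<close>
    sorts \<open>insert b X\<close>.\<close>
  have tw: "(?t \<circ> w) ` insert b X = {1..?k}"
  proof -
    have "?t ` {1..card X} = {1..card X}" by (rule transpose_image_eq) simp
    then have "(?t \<circ> w) ` X = {1..card X}" unfolding image_comp[symmetric] w(2) .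
    moreover have "(?t \<circ> w) b = ?k" using w(4) by simp
    ultimately show ?thesis using iv by (simp only: image_insert)
  qed
  have "w ` insert a X = {1..?k}" using w(2,3) iv by (simp only: image_insert)
  then have "subset_elt c (insert a X) = elt (act w c) ?k"
    using subset_elt_eq[OF c w(1), of "insert a X"] X ab card by auto
  moreover have "subset_elt c (insert b X) = elt (act (?t \<circ> w) c) ?k"
    using subset_elt_eq[OF c Sym_comp[OF t w(1)], of "insert b X"] X ab card tw by auto
  moreover have "act (?t \<circ> w) c = act ?t (act w c)" using act_comp[OF t w(1) c] .
  ultimately have k: "elt (act ?t (act w c)) ?k = elt (act w c) ?k" using eq by simp
  have "act ?t (act w c) = act w c"
  proof (rule max_chain_eqI[OF act_in[OF t m] m])
    fix i assume "i \<le> n"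
    then show "elt (act ?t (act w c)) i = elt (act w c) i"
      using k elt_act_adjacent[of ?k "act w c" i] m kn by (cases "i = ?k") auto
  qed
  \<comment> \<open>Conjugation by \<open>w\<close> converts the adjacent transposition fixing
    \<open>w c\<close> into \<open>(a b)\<close> fixing \<open>c\<close>.\<close>
  moreover have "?t \<circ> w = w \<circ> transpose a b"
    using Sym_comp_transpose[OF w(1), of a b] w(3,4) by simp
  ultimately have "act w (act (transpose a b) c) = act w c"
    using act_comp[OF t w(1) c] act_comp[OF w(1) tab c] by simp
  then have "act (transpose a b) c = act (inv w) (act w c)"
    using act_inv_eq_iff[OF w(1) act_in[OF tab c] m] by simp
  also have "\<dots> = c" using act_inv_eq_iff[OF w(1) c m] by simp
  finally show ?thesis using tab by (simp add: in_stabilizer_iff)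
qed

text \<open>Sorting \<open>X\<close> inside its union with \<open>{a, b}\<close> puts
  \<open>a\<close> and \<open>b\<close> in the next two positions in one of the two orders, and the
  claim is symmetric in them.\<close>

lemma transpose_in_stabilizer:
  assumes c: "c \<in> M" and X: "X \<subseteq> {1..n}" and ab: "a \<in> {1..n} - X" "b \<in> {1..n} - X"
    and eq: "subset_elt c (insert a X) = subset_elt c (insert b X)"
  shows "transpose a b \<in> St c"
proof (cases "a = b")
  case True
  then show ?thesis using stabilizer_id[OF c] by simp
next
  case False
  let ?Y = "insert a (insert b X)"
  have finX: "finite X" using X finite_subset by blast
  have "X \<subseteq> ?Y" "?Y \<subseteq> {1..n}" using X ab by auto
  then obtain w where w: "w \<in> Sym n" "w ` X = {1..card X}" "w ` ?Y = {1..card ?Y}"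
    using sorting_permutation by metis
  have cY: "card ?Y = card X + 2" using finX ab False by simp
  have inj: "inj w" using Sym_inj[OF w(1)] .
  have "w a \<notin> {1..card X}" "w b \<notin> {1..card X}"
    unfolding w(2)[symmetric] inj_image_mem_iff[OF inj] using ab by auto
  moreover have "w a \<in> {1..card X + 2}" "w b \<in> {1..card X + 2}" using w(3) cY by auto
  moreover have "w a \<noteq> w b" using False inj by (metis injD)
  ultimately consider "w a = card X + 1" "w b = card X + 2" | "w b = card X + 1" "w a = card X + 2"
    by fastforce
  then show ?thesis
  proof cases
    case 1
    then show ?thesis using transpose_in_stabilizer_sorted[OF c X ab False eq w(1,2)] by blast
  next
    case 2
    then have "transpose b a \<in> St c"
      using transpose_in_stabilizer_sorted[OF c X ab(2,1) False[symmetric] eq[symmetric] w(1,2)] by blast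
    then show ?thesis by (simp add: transpose_commute)
  qed
qed

section \<open>The blocks of a maximal chain\<close>

definition block_rel :: "'a set \<Rightarrow> (nat \<times> nat) set" where
  "block_rel c = {(a, b). a \<in> {1..n} \<and> b \<in> {1..n} \<and> transpose a b \<in> St c}"

definition blocks :: "'a set \<Rightarrow> nat set set" where
  "blocks c = {1..n} // block_rel c"

lemma equiv_block_rel:
  assumes c: "c \<in> M"
  shows "equiv {1..n} (block_rel c)"
proof (rule equivI)
  show "block_rel c \<subseteq> {1..n} \<times> {1..n}" by (auto simp: block_rel_def)
  show "refl_on {1..n} (block_rel c)" using stabilizer_id[OF c] by (auto simp: refl_on_def block_rel_def)
  show "sym (block_rel c)" by (auto simp: sym_def block_rel_def transpose_commute)
  show "trans (block_rel c)"
  proof (rule transI)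
    fix x y z assume xy: "(x, y) \<in> block_rel c" and yz: "(y, z) \<in> block_rel c"
    \<comment> \<open>This conjugate is \<open>(x z)\<close> when \<open>x\<close> and
      \<open>y\<close> both differ from \<open>z\<close>; the degenerate cases are settled
      separately.\<close>
    have "transpose x y \<circ> transpose y z \<circ> transpose x y \<in> St c"
      using xy yz stabilizer_comp[OF c] by (auto simp: block_rel_def)
    then have "transpose x z \<in> St c" if "x \<noteq> z" "y \<noteq> z" using transpose_comp_triple[of x z y] that by simp
    then show "(x, z) \<in> block_rel c"
      using xy yz stabilizer_id[OF c] by (cases "x = z"; cases "y = z") (auto simp: block_rel_def)
  qed
qed

lemma partition_on_blocks: "c \<in> M \<Longrightarrow> partition_on {1..n} (blocks c)"
  unfolding blocks_def by (rule partition_on_quotient[OF equiv_block_rel])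

lemma Union_blocks: "c \<in> M \<Longrightarrow> \<Union>(blocks c) = {1..n}"
  using partition_onD1[OF partition_on_blocks] by simp

lemma in_same_block:
  assumes "c \<in> M" "B \<in> blocks c" "(a, b) \<in> block_rel c"
  shows "a \<in> B \<longleftrightarrow> b \<in> B"
proof -
  note eq = equiv_block_rel[OF assms(1)]
  have B: "B \<in> {1..n} // block_rel c" using assms(2) by (simp add: blocks_def)
  have "(b, a) \<in> block_rel c" using eq assms(3) by (auto elim: equivE dest: symD)
  then show ?thesis using in_quotient_imp_closed[OF eq B] assms(3) by blast
qed

lemma block_rel_of_same_block:
  assumes "c \<in> M" "B \<in> blocks c" "a \<in> B" "b \<in> B"
  shows "(a, b) \<in> block_rel c"
proof -
  have "B \<in> {1..n} // block_rel c" using assms(2) by (simp add: blocks_def)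
  then show ?thesis using quotient_eq_iff[OF equiv_block_rel[OF assms(1)], of B B a b] assms(3,4) by blast
qed

lemma stabilizer_moves_in_block:
  assumes c: "c \<in> M" and h: "h \<in> St c" and a: "a \<in> {1..n}"
  shows "(a, h a) \<in> block_rel c"
proof -
  have ha: "h a \<in> {1..n}" using h a Sym_in_iff by (auto simp: in_stabilizer_iff)
  have "subset_elt c (h ` {a}) = subset_elt c {a}" using subset_elt_stabilizer[OF c h] a by blast
  then have "transpose a (h a) \<in> St c"
    using transpose_in_stabilizer[OF c, of "{}" a "h a"] a ha by simp
  then show ?thesis using a ha by (simp add: block_rel_def)
qed

lemma stabilizer_eq_young_subgroup:
  assumes c: "c \<in> M"
  shows "St c = young_subgroup n (blocks c)"
proof (intro equalityI subsetI)
  fix h assume h: "h \<in> St c"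
  have "h ` B \<subseteq> B" if B: "B \<in> blocks c" for B
  proof
    fix y assume "y \<in> h ` B"
    then obtain x where x: "x \<in> B" "y = h x" by blast
    then have "x \<in> {1..n}" using Union_blocks[OF c] B by blast
    then show "y \<in> B" using in_same_block[OF c B stabilizer_moves_in_block[OF c h]] x by blast
  qed
  then show "h \<in> young_subgroup n (blocks c)"
    using h by (simp add: young_subgroup_iff[OF partition_on_blocks[OF c]] in_stabilizer_iff)
next
  fix p assume "p \<in> young_subgroup n (blocks c)"
  then have p: "p \<in> Sym n" "\<And>B. B \<in> blocks c \<Longrightarrow> p ` B \<subseteq> B"
    by (auto simp: young_subgroup_iff[OF partition_on_blocks[OF c]])
  show "p \<in> St c"
  \<comment> \<open>A permutation preserving the blocks is a product of transpositions within
    blocks, and those fix \<open>c\<close> by the definition of \<open>block_rel\<close>.\<close>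
  proof (rule permutes_in_closure[where r = "\<lambda>a b. (a, b) \<in> block_rel c"])
    show "p permutes {1..n}" using Sym_permutes p by blast
    show "id \<in> St c" using stabilizer_id[OF c] .
    show "f \<circ> g \<in> St c" if "f \<in> St c" "g \<in> St c" for f g using stabilizer_comp[OF c that] .
    show "transpose a b \<in> St c" if "(a, b) \<in> block_rel c" for a b using that by (simp add: block_rel_def)
    show "(x, z) \<in> block_rel c" if "(x, y) \<in> block_rel c" "(y, z) \<in> block_rel c" for x y z
    proof -
      have "trans (block_rel c)" using equiv_block_rel[OF c] by (rule equivE)
      then show ?thesis using that by (rule transD)
    qed
    show "(x, p x) \<in> block_rel c" if "x \<in> {1..n}" for x
    proof -
      have "x \<in> \<Union>(blocks c)" using that unfolding Union_blocks[OF c] .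
      then obtain B where B: "B \<in> blocks c" "x \<in> B" by blast
      then have "p x \<in> B" using p(2) by blast
      then show ?thesis using block_rel_of_same_block[OF c B(1,2)] by blast
    qed
  qed simp
qed

end

section \<open>Transitive local actions\<close>

context local_sym_action
begin

text \<open>The stabilizer of \<open>w c\<close> is the conjugate by \<open>w\<close> of that of
  \<open>c\<close>. It follows that blocks are relabelled along an orbit and that their shape is
  constant.\<close>

lemma transpose_in_stabilizer_act_iff:
  assumes c: "c \<in> M" and w: "w \<in> Sym n" and ab: "a \<in> {1..n}" "b \<in> {1..n}"
  shows "transpose (w a) (w b) \<in> St (act w c) \<longleftrightarrow> transpose a b \<in> St c"
proof -
  have t: "transpose a b \<in> Sym n" using Sym_transpose ab by blast
  have t': "transpose (w a) (w b) \<in> Sym n" using Sym_transpose Sym_in_iff[OF w] ab by blast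
  have "act (transpose (w a) (w b)) (act w c) = act w (act (transpose a b) c)"
    using act_comp[OF t' w c] act_comp[OF w t c] Sym_comp_transpose[OF w, of a b] by simp
  moreover have "act w (act (transpose a b) c) = act w c \<longleftrightarrow> act (transpose a b) c = c"
    using act_inv_eq_iff[OF w act_in[OF t c] act_in[OF w c]] act_inv_eq_iff[OF w c act_in[OF w c]] by simp
  ultimately show ?thesis using t t' by (simp add: in_stabilizer_iff)
qed

lemma blocks_act:
  assumes c: "c \<in> M" and w: "w \<in> Sym n"
  shows "blocks (act w c) = (`) w ` blocks c"
proof -
  have cls: "block_rel (act w c) `` {w a} = w ` (block_rel c `` {a})" if a: "a \<in> {1..n}" for a
  proof (intro equalityI subsetI)
    fix y assume y: "y \<in> block_rel (act w c) `` {w a}"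
    then have yn: "y \<in> {1..n}" by (simp add: block_rel_def)
    define b where "b = inv w y"
    have b: "b \<in> {1..n}" "y = w b"
      using Sym_in_iff[OF Sym_inv[OF w]] yn Sym_inverses(1)[OF w] by (simp_all add: b_def)
    then have "(a, b) \<in> block_rel c"
      using y a transpose_in_stabilizer_act_iff[OF c w a b(1)] by (simp add: block_rel_def)
    then show "y \<in> w ` (block_rel c `` {a})" using b(2) by blast
  next
    fix y assume "y \<in> w ` (block_rel c `` {a})"
    then obtain b where b: "(a, b) \<in> block_rel c" "y = w b" by blast
    then have "b \<in> {1..n}" "transpose a b \<in> St c" by (auto simp: block_rel_def)
    then show "y \<in> block_rel (act w c) `` {w a}"
      using b(2) a transpose_in_stabilizer_act_iff[OF c w a] Sym_in_iff[OF w] by (simp add: block_rel_def)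
  qed
  have quot: "A // r = (\<lambda>x. r `` {x}) ` A" for A and r :: "(nat \<times> nat) set"
    by (auto simp: quotient_def)
  have "blocks (act w c) = (\<lambda>x. block_rel (act w c) `` {x}) ` (w ` {1..n})"
    unfolding blocks_def quot permutes_image[OF Sym_permutes[OF w]] ..
  also have "\<dots> = (\<lambda>a. w ` (block_rel c `` {a})) ` {1..n}"
    unfolding image_image by (rule image_cong[OF refl cls])
  finally show ?thesis unfolding blocks_def quot image_image .
qed

lemma shape_blocks_act:
  assumes c: "c \<in> M" and w: "w \<in> Sym n"
  shows "shape (blocks (act w c)) = shape (blocks c)"
proof -
  have "inj_on ((`) w) (blocks c)" using inj_image_eq_iff[OF Sym_inj[OF w]] by (auto intro: inj_onI)
  then have "image_mset card (mset_set (blocks (act w c))) = image_mset card (mset_set (blocks c))"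
    unfolding blocks_act[OF c w]
    by (simp add: image_mset_mset_set[symmetric] image_mset.compositionality o_def Sym_card_image[OF w])
  then show ?thesis by (simp add: shape_def)
qed

text \<open>The permutations carrying \<open>c\<close> to \<open>v c\<close> form the coset of
  \<open>St (act v c)\<close> through \<open>v\<close>.\<close>

lemma card_stabilizer_eq_fibre:
  assumes c: "c \<in> M" and v: "v \<in> Sym n"
  shows "card (St (act v c)) = card {w \<in> Sym n. act w c = act v c}"
proof (rule bij_betw_same_card)
  show "bij_betw (\<lambda>h. h \<circ> v) (St (act v c)) {w \<in> Sym n. act w c = act v c}"
  proof (rule bij_betw_byWitness[where f' = "\<lambda>w. w \<circ> inv v"])
    show "(\<lambda>h. h \<circ> v) ` St (act v c) \<subseteq> {w \<in> Sym n. act w c = act v c}"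
      using act_comp[OF _ v c] Sym_comp[OF _ v] by (auto simp: in_stabilizer_iff)
    show "(\<lambda>w. w \<circ> inv v) ` {w \<in> Sym n. act w c = act v c} \<subseteq> St (act v c)"
    proof
      fix h assume "h \<in> (\<lambda>w. w \<circ> inv v) ` {w \<in> Sym n. act w c = act v c}"
      then obtain w where w: "w \<in> Sym n" "act w c = act v c" "h = w \<circ> inv v" by blast
      have h: "h \<in> Sym n" using w Sym_comp Sym_inv[OF v] by blast
      have "h \<circ> v = w" unfolding w(3) comp_assoc Sym_inverses(4)[OF v] by simp
      then have "act h (act v c) = act v c" using act_comp[OF h v c] w(2) by simp
      then show "h \<in> St (act v c)" using h by (simp add: in_stabilizer_iff)
    qed
  qed (simp_all add: comp_assoc Sym_inverses(3,4)[OF v])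
qed

text \<open>Orbit counting without division: the fibres of the orbit map partition
  \<open>Sym n\<close>.\<close>

lemma sum_card_stabilizer_orbit:
  assumes c: "c \<in> M"
  shows "(\<Sum>m\<in>(\<lambda>w. act w c) ` Sym n. card (St m)) = fact n"
proof -
  have "(\<Sum>m\<in>(\<lambda>w. act w c) ` Sym n. card (St m)) =
    (\<Sum>m\<in>(\<lambda>w. act w c) ` Sym n. \<Sum>w | w \<in> Sym n \<and> act w c = m. 1)"
    by (intro sum.cong refl) (auto simp: card_stabilizer_eq_fibre[OF c])
  also have "\<dots> = (\<Sum>w\<in>Sym n. 1)" by (rule sum.image_gen[OF finite_Sym, symmetric])
  finally show ?thesis by (simp add: card_Sym)
qed

definition weight :: "'a set \<Rightarrow> real" where
  "weight m = real (\<Prod>B\<in>blocks m. fact (card B)) / fact n"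

lemma weight_pos: "weight m > 0"
  unfolding weight_def by (simp add: prod_pos)

lemma weight_eq_card_stabilizer: "m \<in> M \<Longrightarrow> weight m = real (card (St m)) / fact n"
  unfolding weight_def
  by (simp add: stabilizer_eq_young_subgroup card_young_subgroup[OF partition_on_blocks])

lemma frob_ch_eq_sum_weights:
  "frob_ch n (perm_character P le act) = (\<Sum>m\<in>M. const_sp (weight m) * h_nu n (shape (blocks m)))"
  unfolding weight_def
  by (rule frob_ch_eq_sum_shapes[OF finite_max_chains partition_on_blocks stabilizer_eq_young_subgroup])

text \<open>The orbit of \<open>c\<close> alone has total weight 1, and any chain outside it would
  add positive weight.\<close>

lemma transitive_of_sum_weights:
  assumes c: "c \<in> M" and sum: "sum weight M = 1" and m: "m \<in> M"
  shows "\<exists>w\<in>Sym n. m = act w c"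
proof (rule ccontr)
  assume no: "\<not> (\<exists>w\<in>Sym n. m = act w c)"
  let ?O = "(\<lambda>w. act w c) ` Sym n"
  have O: "?O \<subseteq> M" using act_in c by blast
  have "sum weight ?O = (\<Sum>m\<in>?O. real (card (St m)) / fact n)"
    by (rule sum.cong) (use O weight_eq_card_stabilizer in auto)
  also have "\<dots> = real (\<Sum>m\<in>?O. card (St m)) / fact n"
    by (simp add: sum_divide_distrib[symmetric])
  also have "\<dots> = 1" unfolding sum_card_stabilizer_orbit[OF c] by simp
  finally have "sum weight (insert m ?O) = weight m + 1"
    using no finite_Sym by (subst sum.insert) auto
  moreover have "sum weight (insert m ?O) \<le> sum weight M"
    using O m finite_max_chains weight_pos by (intro sum_mono2) (auto intro: less_imp_le)
  ultimately show False using sum weight_pos[of m] by simp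
qed

end

locale transitive_local_sym_action = local_sym_action P le bot0 top1 n act
  for P :: "'a set" and le bot0 top1 n act +
  fixes c :: "'a set"
  assumes c: "c \<in> M" and transitive: "m \<in> M \<Longrightarrow> \<exists>w\<in>Sym n. m = act w c"
begin

abbreviation "T \<equiv> subset_elt c"
abbreviation "Bs \<equiv> blocks c"

section \<open>Block counts and the order on \<open>P\<close>\<close>

lemma block_rel_trans: "(x, y) \<in> block_rel c \<Longrightarrow> (y, z) \<in> block_rel c \<Longrightarrow> (x, z) \<in> block_rel c"
  using equiv_block_rel[OF c] by (elim equivE) (rule transD)

text \<open>Stated as an equivalence because it is read from right to left when flags are built from
  the bottom and from left to right when they are dismantled from the top.\<close>

lemma card_insert_in_block:
  assumes "B \<in> Bs" "(a, b) \<in> block_rel c" "a \<notin> X" "b \<notin> Y" "finite X" "finite Y"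
  shows "card (insert a X \<inter> B) = card (insert b Y \<inter> B) \<longleftrightarrow> card (X \<inter> B) = card (Y \<inter> B)"
  using assms in_same_block[OF c assms(1,2)] by (auto simp: Int_insert_left)

text \<open>Exchange argument: for \<open>a\<close> in \<open>S - S'\<close>, counting in its block
  yields \<open>b\<close> in \<open>S' - S\<close>. The transposition of \<open>a\<close> and
  \<open>b\<close> fixes \<open>c\<close>, keeps all block counts and brings \<open>S\<close> one
  element closer to \<open>S'\<close>.\<close>

lemma move_into:
  assumes "S \<subseteq> {1..n}" "S' \<subseteq> {1..n}" "\<forall>B\<in>Bs. card (S \<inter> B) \<le> card (S' \<inter> B)"
  shows "\<exists>h\<in>St c. h ` S \<subseteq> S'"
  using assms
proof (induction "card (S - S')" arbitrary: S rule: less_induct)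
  case less
  have fin: "finite S" "finite S'" using less.prems finite_subset by blast+
  show ?case
  proof (cases "S \<subseteq> S'")
    case True
    then show ?thesis using stabilizer_id[OF c] by (intro bexI[of _ id]) auto
  next
    case False
    then obtain a where a: "a \<in> S" "a \<notin> S'" by blast
    then have "a \<in> \<Union>Bs" using less.prems(1) Union_blocks[OF c] by blast
    then obtain B where B: "B \<in> Bs" "a \<in> B" by blast
    have "\<not> S' \<inter> B \<subseteq> S \<inter> B"
    proof
      assume "S' \<inter> B \<subseteq> S \<inter> B"
      then have "S' \<inter> B \<subset> S \<inter> B" using a B by blast
      then have "card (S' \<inter> B) < card (S \<inter> B)" using fin by (intro psubset_card_mono) auto
      then show False using less.prems(3) B(1) by (metis not_less)
    qed
    then obtain b where b: "b \<in> S'" "b \<in> B" "b \<notin> S" by blast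
    have rel: "(a, b) \<in> block_rel c" using block_rel_of_same_block[OF c B b(2)] .
    then have t: "transpose a b \<in> St c" by (simp add: block_rel_def)
    have tS: "transpose a b ` S = insert b (S - {a})"
      using a b by (auto simp: in_transpose_image_iff transpose_eq_iff transpose_def split: if_splits)
    have "insert b (S - {a}) - S' = (S - S') - {a}" using b a by blast
    then have less: "card (transpose a b ` S - S') < card (S - S')"
      unfolding tS using card_Diff1_less[of "S - S'" a] a fin by simp
    have sub: "transpose a b ` S \<subseteq> {1..n}" unfolding tS using less.prems b by blast
    have "card (transpose a b ` S \<inter> C) = card (S \<inter> C)" if C: "C \<in> Bs" for C
      using card_insert_in_block[OF C rel, of "S - {a}" "S - {a}"] fin(1) b(3)
      unfolding tS insert_Diff[OF a(1)] by simp
    then obtain h where h: "h \<in> St c" "h ` (transpose a b ` S) \<subseteq> S'"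
      using less.hyps[OF less sub less.prems(2)] less.prems(3) by auto
    have "(h \<circ> transpose a b) ` S \<subseteq> S'" using h(2) unfolding image_comp .
    then show ?thesis using stabilizer_comp[OF c h(1) t] by blast
  qed
qed

lemma move_onto:
  assumes "S \<subseteq> {1..n}" "S' \<subseteq> {1..n}" "\<forall>B\<in>Bs. card (S \<inter> B) = card (S' \<inter> B)" "card S = card S'"
  shows "\<exists>h\<in>St c. h ` S = S'"
proof -
  obtain h where h: "h \<in> St c" "h ` S \<subseteq> S'" using move_into[OF assms(1,2)] assms(3) by auto
  have "h \<in> Sym n" using h(1) by (simp add: in_stabilizer_iff)
  then have "card (h ` S) = card S'" using Sym_card_image assms(4) by metis
  moreover have "finite S'" using assms(2) finite_subset by blast
  ultimately have "h ` S = S'" using card_subset_eq h(2) by metis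
  then show ?thesis using h by blast
qed

text \<open>A stabilizer element \<open>h\<close> aligns \<open>X\<close> with \<open>Y\<close>;
  then \<open>h a\<close> and \<open>b\<close> are added to the same set, and \<open>h a\<close>
  shares the block of \<open>a\<close>.\<close>

lemma same_block_of_insert:
  assumes X: "X \<subseteq> {1..n}" and Y: "Y \<subseteq> {1..n}" and a: "a \<in> {1..n} - X" and b: "b \<in> {1..n} - Y"
    and eq: "\<forall>B\<in>Bs. card (X \<inter> B) = card (Y \<inter> B)" "card X = card Y"
    and T: "T (insert a X) = T (insert b Y)"
  shows "(a, b) \<in> block_rel c"
proof -
  obtain h where h: "h \<in> St c" "h ` X = Y" using move_onto[OF X Y eq] by blast
  have hn: "h \<in> Sym n" using h(1) by (simp add: in_stabilizer_iff)
  have "T (insert (h a) Y) = T (insert b Y)"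
    using subset_elt_stabilizer[OF c h(1), of "insert a X"] X a T h(2) by simp
  moreover have ha: "h a \<in> {1..n} - Y"
    using a Sym_in_iff[OF hn] inj_image_mem_iff[OF Sym_inj[OF hn], of a X] h(2) by blast
  ultimately have "transpose (h a) b \<in> St c" using transpose_in_stabilizer[OF c Y _ b] by blast
  then have "(h a, b) \<in> block_rel c" using ha b by (simp add: block_rel_def)
  moreover have "(a, h a) \<in> block_rel c" using stabilizer_moves_in_block[OF c h(1)] a by blast
  ultimately show ?thesis using block_rel_trans by blast
qed

text \<open>The downward counterpart: here the larger sets are aligned, and removing
  \<open>h a\<close> or \<open>b\<close> from one set is viewed as inserting the other into what
  remains.\<close>

lemma same_block_of_remove:
  assumes X: "X \<subseteq> {1..n}" and Y: "Y \<subseteq> {1..n}" and a: "a \<in> {1..n} - X" and b: "b \<in> {1..n} - Y"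
    and eq: "\<forall>B\<in>Bs. card (insert a X \<inter> B) = card (insert b Y \<inter> B)" "card X = card Y"
    and T: "T X = T Y"
  shows "(a, b) \<in> block_rel c"
proof -
  have fin: "finite X" "finite Y" using X Y finite_subset by blast+
  have sub: "insert a X \<subseteq> {1..n}" "insert b Y \<subseteq> {1..n}" using X Y a b by auto
  have "card (insert a X) = card (insert b Y)" using a b eq(2) fin by simp
  from move_onto[OF sub eq(1) this]
  obtain h where h: "h \<in> St c" "h ` insert a X = insert b Y" by blast
  have hn: "h \<in> Sym n" using h(1) by (simp add: in_stabilizer_iff)
  have ha: "h a \<in> {1..n}" using a Sym_in_iff[OF hn] by blast
  have haX: "h a \<notin> h ` X" using inj_image_mem_iff[OF Sym_inj[OF hn], of a X] a by blast
  have "(h a, b) \<in> block_rel c"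
  proof (cases "h a = b")
    case True
    then show ?thesis using stabilizer_id[OF c] b by (simp add: block_rel_def)
  next
    case False
    define Z where "Z = Y - {h a}"
    have ins: "insert (h a) (h ` X) = insert b Y" using h(2) by simp
    then have "h a \<in> Y" using False by blast
    then have Y': "Y = insert (h a) Z" by (auto simp: Z_def)
    have "h ` X = insert b Y - {h a}" using ins haX by blast
    then have X': "h ` X = insert b Z" using False by (auto simp: Z_def)
    have "T (insert (h a) Z) = T (insert b Z)"
      using subset_elt_stabilizer[OF c h(1) X] T unfolding X' Y' by simp
    then have "transpose (h a) b \<in> St c"
      using transpose_in_stabilizer[OF c, of Z "h a" b] Y ha b by (auto simp: Z_def)
    then show ?thesis using ha b by (simp add: block_rel_def)
  qed
  moreover have "(a, h a) \<in> block_rel c" using stabilizer_moves_in_block[OF c h(1)] a by blast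
  ultimately show ?thesis using block_rel_trans by blast
qed

lemma preimage_Suc:
  assumes v: "v \<in> Sym n" and i: "i < n"
  shows "inv v ` {1..Suc i} = insert (inv v (Suc i)) (inv v ` {1..i})"
    "inv v (Suc i) \<in> {1..n} - inv v ` {1..i}" "inv v ` {1..i} \<subseteq> {1..n}" "card (inv v ` {1..i}) = i"
proof -
  note v' = Sym_inv[OF v]
  have "{1..Suc i} = insert (Suc i) {1..i}" by auto
  then show "inv v ` {1..Suc i} = insert (inv v (Suc i)) (inv v ` {1..i})" by simp
  show "inv v (Suc i) \<in> {1..n} - inv v ` {1..i}"
    using Sym_in_iff[OF v', of "Suc i"] inj_image_mem_iff[OF Sym_inj[OF v'], of "Suc i" "{1..i}"] i by auto
  show "inv v ` {1..i} \<subseteq> {1..n}" using Sym_image_subset[OF v'] i by simp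
  show "card (inv v ` {1..i}) = i" using Sym_card_image[OF v'] by simp
qed

lemma block_counts_agree_below:
  assumes v: "v \<in> Sym n" and w: "w \<in> Sym n" and "i \<le> n"
    and "\<And>j. j \<le> i \<Longrightarrow> elt (act v c) j = elt (act w c) j"
  shows "\<forall>B\<in>Bs. card (inv v ` {1..i} \<inter> B) = card (inv w ` {1..i} \<inter> B)"
  using assms(3,4)
proof (induction i)
  case (Suc i)
  have i: "i < n" using Suc.prems by simp
  note pv = preimage_Suc[OF v i] and pw = preimage_Suc[OF w i]
  have IH: "\<forall>B\<in>Bs. card (inv v ` {1..i} \<inter> B) = card (inv w ` {1..i} \<inter> B)" using Suc by simp
  have "T (inv v ` {1..Suc i}) = T (inv w ` {1..Suc i})"
    using elt_act[OF c v Suc.prems(1)] elt_act[OF c w Suc.prems(1)] Suc.prems(2)[of "Suc i"] by simp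
  then have rel: "(inv v (Suc i), inv w (Suc i)) \<in> block_rel c"
    using same_block_of_insert[OF pv(3) pw(3) pv(2) pw(2) IH] pv(1,4) pw(1,4) by simp
  show ?case
  proof
    fix B assume B: "B \<in> Bs"
    show "card (inv v ` {1..Suc i} \<inter> B) = card (inv w ` {1..Suc i} \<inter> B)"
      unfolding pv(1) pw(1)
      using card_insert_in_block[OF B rel, of "inv v ` {1..i}" "inv w ` {1..i}"] pv(2) pw(2) IH B by blast
  qed
qed simp

lemma block_counts_agree_above:
  assumes v: "v \<in> Sym n" and w: "w \<in> Sym n" and "i \<le> n"
    and "\<And>j. i \<le> j \<Longrightarrow> j \<le> n \<Longrightarrow> elt (act v c) j = elt (act w c) j"
  shows "\<forall>B\<in>Bs. card (inv v ` {1..i} \<inter> B) = card (inv w ` {1..i} \<inter> B)"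
  using assms(3,4)
\<comment> \<open>Descending from rank \<open>n\<close>, where both preimages are all of
  \<open>{1..n}\<close>.\<close>
proof (induction i rule: inc_induct)
  case base
  then show ?case
    using permutes_image[OF Sym_permutes[OF Sym_inv[OF v]]] permutes_image[OF Sym_permutes[OF Sym_inv[OF w]]] by simp
next
  case (step i)
  have i: "i < n" using step by simp
  note pv = preimage_Suc[OF v i] and pw = preimage_Suc[OF w i]
  have IH: "\<forall>B\<in>Bs. card (insert (inv v (Suc i)) (inv v ` {1..i}) \<inter> B) =
      card (insert (inv w (Suc i)) (inv w ` {1..i}) \<inter> B)"
    using step pv(1) pw(1) by simp
  have "T (inv v ` {1..i}) = T (inv w ` {1..i})"
    using elt_act[OF c v] elt_act[OF c w] step.prems[of i] i by simp
  then have rel: "(inv v (Suc i), inv w (Suc i)) \<in> block_rel c"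
    using same_block_of_remove[OF pv(3) pw(3) pv(2) pw(2) IH] pv(4) pw(4) by simp
  show ?case
  proof
    fix B assume B: "B \<in> Bs"
    show "card (inv v ` {1..i} \<inter> B) = card (inv w ` {1..i} \<inter> B)"
      using card_insert_in_block[OF B rel, of "inv v ` {1..i}" "inv w ` {1..i}"] pv(2) pw(2) IH B by blast
  qed
qed

text \<open>The chain following one chain below the common element and the other one above it is again
  in the orbit of \<open>c\<close>, so the comparison can be made in two steps.\<close>

lemma block_counts_of_subset_elt_eq:
  assumes S: "S \<subseteq> {1..n}" and S': "S' \<subseteq> {1..n}" and eq: "T S = T S'" and B: "B \<in> Bs"
  shows "card (S \<inter> B) = card (S' \<inter> B)"
proof -
  obtain w where w: "w \<in> Sym n" "inv w ` {1..card S} = S" "card S \<le> n"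
    "T S = elt (act w c) (card S)" "rk (T S) = card S"
    by (rule subset_elt_in[OF c S])
  obtain w' where w': "w' \<in> Sym n" "inv w' ` {1..card S'} = S'"
    "T S' = elt (act w' c) (card S')" "rk (T S') = card S'"
    by (rule subset_elt_in[OF c S'])
  have card: "card S' = card S" using eq w(5) w'(4) by simp
  have "elt (act w c) (card S) = elt (act w' c) (card S)" using eq w(4) w'(3) card by simp
  from splice_max_chains[OF act_in[OF w(1) c] act_in[OF w'(1) c] w(3) this]
  obtain d where d: "d \<in> M" "\<And>j. j \<le> card S \<Longrightarrow> elt d j = elt (act w c) j"
    "\<And>j. card S \<le> j \<Longrightarrow> j \<le> n \<Longrightarrow> elt d j = elt (act w' c) j" by blast
  obtain v where v: "v \<in> Sym n" "d = act v c" using transitive[OF d(1)] by blast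
  have "card (inv v ` {1..card S} \<inter> B) = card (inv w ` {1..card S} \<inter> B)"
    using block_counts_agree_below[OF v(1) w(1) w(3)] d(2) v(2) B by blast
  moreover have "card (inv v ` {1..card S} \<inter> B) = card (inv w' ` {1..card S} \<inter> B)"
    using block_counts_agree_above[OF v(1) w'(1) w(3)] d(3) v(2) B by blast
  ultimately show ?thesis using w(2) w'(2) card by simp
qed

lemma subset_elt_le_iff:
  assumes S: "S \<subseteq> {1..n}" and S': "S' \<subseteq> {1..n}"
  shows "le (T S) (T S') \<longleftrightarrow> (\<forall>B\<in>Bs. card (S \<inter> B) \<le> card (S' \<inter> B))"
proof
  assume "\<forall>B\<in>Bs. card (S \<inter> B) \<le> card (S' \<inter> B)"
  then obtain h where h: "h \<in> St c" "h ` S \<subseteq> S'" using move_into[OF S S'] by blast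
  then show "le (T S) (T S')"
    using subset_elt_stabilizer[OF c h(1) S] subset_elt_le[OF c h(2) S'] by simp
next
  assume le: "le (T S) (T S')"
  obtain SP: "T S \<in> P" "rk (T S) = card S" "card S \<le> n" by (rule subset_elt_in[OF c S])
  obtain SP': "T S' \<in> P" "rk (T S') = card S'" "card S' \<le> n" by (rule subset_elt_in[OF c S'])
  \<comment> \<open>\<open>S\<close> and \<open>S'\<close> need not be nested. A chain through both
    elements lies in the orbit of \<open>c\<close>, so it supplies nested sets with the same images
    under \<open>T\<close>, and therefore with the same block counts.\<close>
  obtain m where m: "m \<in> M" "T S \<in> m" "T S' \<in> m" using max_chain_through[OF SP(1) SP'(1) le] .
  obtain v where v: "v \<in> Sym n" "m = act v c" using transitive[OF m(1)] by blast
  have cards: "card S \<le> card S'" using le_iff_rank_le[OF m] le SP(2) SP'(2) by simp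
  have 1: "T (inv v ` {1..card S}) = T S"
    using elt_act[OF c v(1) SP(3)] elt_rank[OF m(1,2)] SP(2) v(2) by simp
  have 2: "T (inv v ` {1..card S'}) = T S'"
    using elt_act[OF c v(1) SP'(3)] elt_rank[OF m(1,3)] SP'(2) v(2) by simp
  have sub: "inv v ` {1..k} \<subseteq> {1..n}" if "k \<le> n" for k
    using Sym_image_subset[OF Sym_inv[OF v(1)]] that by simp
  show "\<forall>B\<in>Bs. card (S \<inter> B) \<le> card (S' \<inter> B)"
  proof
    fix B assume B: "B \<in> Bs"
    have "card (S \<inter> B) = card (inv v ` {1..card S} \<inter> B)"
      using block_counts_of_subset_elt_eq[OF sub[OF SP(3)] S 1 B] by simp
    also have "\<dots> \<le> card (inv v ` {1..card S'} \<inter> B)"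
      by (rule card_mono) (use cards in auto)
    also have "\<dots> = card (S' \<inter> B)"
      using block_counts_of_subset_elt_eq[OF sub[OF SP'(3)] S' 2 B] .
    finally show "card (S \<inter> B) \<le> card (S' \<inter> B)" .
  qed
qed

lemma subset_elt_surj:
  assumes "x \<in> P"
  obtains S where "S \<subseteq> {1..n}" "T S = x"
proof -
  obtain m where m: "m \<in> M" "x \<in> m" using max_chain_through[OF assms assms le_refl[OF assms]] by metis
  obtain v where v: "v \<in> Sym n" "m = act v c" using transitive[OF m(1)] by blast
  have "T (inv v ` {1..rk x}) = x" using elt_act[OF c v(1) rank_le[OF m]] elt_rank[OF m] v(2) by simp
  moreover have "inv v ` {1..rk x} \<subseteq> {1..n}"
    using Sym_image_subset[OF Sym_inv[OF v(1)]] rank_le[OF m] by simp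
  ultimately show ?thesis using that by blast
qed

text \<open>An element is sent to the block counts of any set representing it. Injectivity follows
  from the order criterion by antisymmetry; surjectivity needs that the counts do not depend on the
  representative.\<close>

lemma iso_to_chain_product:
  assumes bs: "set bs = Bs" "distinct bs" and \<nu>: "\<nu> = map card bs"
  shows "poset_iso_to_chain_product P le \<nu>"
proof -
  \<comment> \<open>The value 0 past the last block matches the padding in
    \<open>chain_product\<close>.\<close>
  define cnt where "cnt S i = (if i < length \<nu> then card (S \<inter> bs ! i) else 0)" for S i
  define pre where "pre x = (SOME S. S \<subseteq> {1..n} \<and> T S = x)" for x
  define \<phi> where "\<phi> x = cnt (pre x)" for x
  have len: "length \<nu> = length bs" using \<nu> by simp
  have pre: "pre x \<subseteq> {1..n} \<and> T (pre x) = x" if x: "x \<in> P" for x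
  proof -
    have "\<exists>S. S \<subseteq> {1..n} \<and> T S = x" using subset_elt_surj[OF x] by metis
    then show ?thesis unfolding pre_def by (rule someI_ex)
  qed
  have cnt_le: "(\<forall>B\<in>Bs. card (S \<inter> B) \<le> card (S' \<inter> B)) \<longleftrightarrow> (\<forall>i. cnt S i \<le> cnt S' i)" for S S'
    unfolding bs(1)[symmetric] cnt_def len by (auto simp: all_set_conv_all_nth)
  have le_iff: "le x y \<longleftrightarrow> (\<forall>i. \<phi> x i \<le> \<phi> y i)" if xy: "x \<in> P" "y \<in> P" for x y
  proof -
    note px = pre[OF xy(1)] and py = pre[OF xy(2)]
    have "le (T (pre x)) (T (pre y)) \<longleftrightarrow> (\<forall>i. cnt (pre x) i \<le> cnt (pre y) i)"
      unfolding cnt_le[symmetric] by (rule subset_elt_le_iff[OF conjunct1[OF px] conjunct1[OF py]])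
    then show ?thesis unfolding conjunct2[OF px] conjunct2[OF py] \<phi>_def .
  qed
  have finB: "finite (bs ! i)" if "i < length bs" for i
  proof (rule finite_subset)
    have "bs ! i \<in> Bs" using nth_mem[OF that] bs(1) by simp
    then show "bs ! i \<subseteq> {1..n}" using Union_blocks[OF c] by blast
  qed simp
  have "inj_on \<phi> P"
  proof (rule inj_onI)
    fix x y assume xy: "x \<in> P" "y \<in> P" "\<phi> x = \<phi> y"
    then show "x = y" using le_antisym[OF xy(1,2)] le_iff[OF xy(1,2)] le_iff[OF xy(2,1)] by simp
  qed
  moreover have "\<phi> ` P \<subseteq> chain_product \<nu>"
  proof
    fix f assume "f \<in> \<phi> ` P"
    then obtain x where "f = cnt (pre x)" by (auto simp: \<phi>_def)
    then show "f \<in> chain_product \<nu>"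
      using finB by (simp add: chain_product_def cnt_def \<nu> card_mono)
  qed
  moreover have "chain_product \<nu> \<subseteq> \<phi> ` P"
  proof
    fix f assume f: "f \<in> chain_product \<nu>"
    have "\<exists>A. A \<subseteq> bs ! i \<and> card A = f i" if "i < length bs" for i
    proof -
      have "f i \<le> card (bs ! i)" using f that by (simp add: chain_product_def \<nu>)
      then show ?thesis by (meson obtain_subset_with_card_n)
    qed
    then obtain A where A: "\<And>i. i < length bs \<Longrightarrow> A i \<subseteq> bs ! i \<and> card (A i) = f i" by metis
    define S where "S = (\<Union>i<length bs. A i)"
    have "S \<subseteq> \<Union>(set bs)" unfolding S_def using A by (meson UN_least Union_upper lessThan_iff nth_mem subset_trans)
    then have S: "S \<subseteq> {1..n}" unfolding bs(1) Union_blocks[OF c] .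
    have "S \<inter> bs ! i = A i" if i: "i < length bs" for i
    proof (intro equalityI subsetI)
      fix x assume x: "x \<in> S \<inter> bs ! i"
      then obtain j where j: "j < length bs" "x \<in> A j" unfolding S_def by blast
      have xj: "x \<in> bs ! j" using A[OF j(1)] j(2) by blast
      have "bs ! i \<in> Bs" "bs ! j \<in> Bs" using nth_mem i j(1) bs(1) by auto
      then have "bs ! i = bs ! j"
        using disjointD[OF partition_onD2[OF partition_on_blocks[OF c]]] x xj by blast
      then have "i = j" using nth_eq_iff_index_eq[OF bs(2) i j(1)] by simp
      then show "x \<in> A i" using j by simp
    qed (use A i in \<open>auto simp: S_def\<close>)
    then have "cnt S i = f i" for i
      using A[of i] f by (cases "i < length bs") (simp_all add: cnt_def len chain_product_def)
    then have cntS: "cnt S = f" by (rule ext)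
    have x: "T S \<in> P" by (rule subset_elt_in[OF c S])
    have "card (pre (T S) \<inter> bs ! i) = card (S \<inter> bs ! i)" if "i < length bs" for i
      using block_counts_of_subset_elt_eq[OF conjunct1[OF pre[OF x]] S conjunct2[OF pre[OF x]]]
        nth_mem[OF that] bs(1) by blast
    then have "\<phi> (T S) = f" unfolding cntS[symmetric] \<phi>_def by (simp add: cnt_def len fun_eq_iff)
    then show "f \<in> \<phi> ` P" using x by (rule image_eqI[OF sym])
  qed
  ultimately have "bij_betw \<phi> P (chain_product \<nu>)" by (auto simp: bij_betw_def)
  then show ?thesis unfolding poset_iso_to_chain_product_def
    by (intro exI[of _ \<phi>] conjI ballI le_iff)
qed

end

text \<open>Only the multiset of block sizes is known; this orders the blocks so that their sizes
  spell out the given partition.\<close>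

lemma list_of_image_mset:
  assumes "image_mset f A = mset ys"
  shows "\<exists>xs. mset xs = A \<and> map f xs = ys"
  using assms
proof (induction ys arbitrary: A)
  case (Cons y ys)
  then have "y \<in># image_mset f A" by simp
  then obtain x where x: "x \<in># A" "f x = y" by auto
  then obtain A' where A: "A = add_mset x A'" by (meson multi_member_split)
  then have "image_mset f A' = mset ys" using Cons.prems x by simp
  then obtain xs where "mset xs = A'" "map f xs = ys" using Cons.IH by blast
  then show ?case using A x by (intro exI[of _ "x # xs"]) simp
qed simp

theorem theorem4p3:
  fixes P :: "'a set" and le :: "'a \<Rightarrow> 'a \<Rightarrow> bool" and bot0 top1 :: 'a and n :: nat
    and act :: "(nat \<Rightarrow> nat) \<Rightarrow> 'a set \<Rightarrow> 'a set"
  assumes "ranked_bounded_poset P le bot0 top1 n"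
    and "local_action P le n act"
  shows "(\<forall>c\<in>max_chains P le. \<exists>Bs. partition_on {1..n} Bs \<and>
            stabilizer P le n act c = young_subgroup n Bs)
       \<and> h_positive n (frob_ch n (perm_character P le act))
       \<and> (\<forall>\<nu>\<in>int_partitions n. frob_ch n (perm_character P le act) = h_nu n \<nu>
            \<longrightarrow> poset_iso_to_chain_product P le \<nu>)"
proof -
  interpret local_sym_action P le bot0 top1 n act
    using assms by unfold_locales
  have shapes: "shape (blocks m) \<in> int_partitions n" if "m \<in> M" for m
    using shape_in_int_partitions[OF partition_on_blocks[OF that]] .
  have a: "\<forall>c\<in>M. \<exists>Bs. partition_on {1..n} Bs \<and> St c = young_subgroup n Bs"
    using partition_on_blocks stabilizer_eq_young_subgroup by blast
  have b: "h_positive n (frob_ch n (perm_character P le act))"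
    unfolding frob_ch_eq_sum_weights
    by (rule h_positive_sum[OF finite_max_chains less_imp_le[OF weight_pos] shapes])
  have "poset_iso_to_chain_product P le \<nu>"
    if \<nu>: "\<nu> \<in> int_partitions n" and ch: "frob_ch n (perm_character P le act) = h_nu n \<nu>" for \<nu>
  proof -
    have one: "sum weight M = 1"
      using sum_weights_eq_one[OF ch[unfolded frob_ch_eq_sum_weights] \<nu> shapes] .
    \<comment> \<open>A base chain for the orbit comes from extending the empty chain.\<close>
    have "is_chain P le {}" by (simp add: is_chain_def)
    then obtain c where c: "c \<in> M" using extend_chain by blast
    note tr = transitive_of_sum_weights[OF c one]
    interpret transitive_local_sym_action P le bot0 top1 n act c
      using c tr by unfold_locales
    \<comment> \<open>By transitivity every chain has the shape of \<open>c\<close>, so the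
      characteristic collapses to a single product with coefficient 1.\<close>
    have "h_nu n \<nu> = (\<Sum>m\<in>M. const_sp (weight m) * h_nu n (shape (blocks c)))"
      unfolding ch[symmetric] frob_ch_eq_sum_weights
      by (intro sum.cong refl) (use tr shape_blocks_act[OF c] in metis)
    also have "\<dots> = const_sp (sum weight M) * h_nu n (shape (blocks c))"
      by (simp add: const_sp_sum sum_distrib_right)
    also have "\<dots> = h_nu n (shape (blocks c))" unfolding one by (simp add: const_sp_def)
    finally have "mset (shape (blocks c)) = mset \<nu>"
      using h_nu_inj[OF _ shapes[OF c] \<nu>] by simp
    then obtain bs where bs: "mset bs = mset_set (blocks c)" "map card bs = \<nu>"
      using list_of_image_mset[of card "mset_set (blocks c)" \<nu>] mset_shape by metis
    have fin: "finite (blocks c)" using finite_elements[OF _ partition_on_blocks[OF c]] by simp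
    then have "set bs = blocks c" using bs(1) by (metis finite_set_mset_mset_set set_mset_mset)
    moreover from this have "distinct bs"
      unfolding distinct_count_atmost_1 bs(1) using fin by (simp add: count_mset_set')
    ultimately show ?thesis using iso_to_chain_product bs(2)[symmetric] by blast
  qed
  then show ?thesis using a b by blast
qed

end
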